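(* Let $(u,v,g,h)$ be the unique global solution of the free boundary problem described in the context, and suppose $(\beta,\mu)\in\mathcal{A}$, where $\mathcal{A}=\{(\beta,\mu):\beta,\mu>0,\ k(\beta,d,a)<k(\mu,1,1)\}$. If $b>a$ and $h_\infty=\infty$, then $g_\infty<\infty$.
   Context: Let $a,b,c,d,\beta,\mu>0$ and $0<h_0\le g_0$. Let $u_0\in C^2([0,g_0])$ with $u_0'(0)=0$, $u_0>0$ in $[0,g_0)$, $u_0=0$ in $[g_0,\infty)$, and $v_0\in C^2([0,h_0])$ with $v_0'(0)=0$, $v_0>0$ in $[0,h_0)$, $v_0=0$ in $[h_0,\infty)$. The problem is: $u_t-du_{xx}=u(a-u-bv)$ for $t>0$, $0<x<g(t)$; $v_t-v_{xx}=v(1-v+cu)$ for $t>0$, $0<x<h(t)$; $u_x(t,0)=v_x(t,0)=0$; $g'(t)=-\beta u_x(t,g(t))$, $h'(t)=-\mu v_x(t,h(t))$; $u(t,x)=0$ for $x\ge g(t)$, $v(t,x)=0$ for $x\ge h(t)$; $u(0,\cdot)=u_0$, $v(0,\cdot)=v_0$, $g(0)=g_0$, $h(0)=h_0$. It has a unique global classical solution with $g,h$ increasing; $g_\infty=\lim g(t)$, $h_\infty=\lim h(t)$. For $\nu,D,\theta>0$, $k(\nu,D,\theta)$ denotes the unique $k\in(0,2\sqrt{\theta D})$ for which there is a function $q$ with $Dq''-kq'+q(\theta-q)=0$ on $(0,\infty)$, $q(0)=0$, $q'(0)=k/\nu$, $q(\infty)=\theta$, $q'>0$ on $(0,\infty)$.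 *)

theory Defs
  imports "HOL-Analysis.Analysis"
begin

definition semi_wave :: "real \<Rightarrow> real \<Rightarrow> real \<Rightarrow> real \<Rightarrow> (real \<Rightarrow> real) \<Rightarrow> bool" where
  "semi_wave \<nu> D \<theta> k q \<longleftrightarrow>
     (\<exists>q' q''.
        (\<forall>x\<ge>0. (q has_real_derivative q' x) (at x within {0..})) \<and>
        continuous_on {0..} q' \<and>
        (\<forall>x>0. (q' has_real_derivative q'' x) (at x)) \<and>
        (\<forall>x>0. D * q'' x - k * q' x + q x * (\<theta> - q x) = 0) \<and>
        q 0 = 0 \<and> q' 0 = k / \<nu> \<and>
        (q \<longlongrightarrow> \<theta>) at_top \<and>
        (\<forall>x>0. q' x > 0))"

definition kspeed :: "real \<Rightarrow> real \<Rightarrow> real \<Rightarrow> real" where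
  "kspeed \<nu> D \<theta> = (THE k. 0 < k \<and> k < 2 * sqrt (\<theta> * D) \<and> (\<exists>q. semi_wave \<nu> D \<theta> k q))"

definition C2_on_interval :: "real \<Rightarrow> real \<Rightarrow> (real \<Rightarrow> real) \<Rightarrow> (real \<Rightarrow> real) \<Rightarrow> bool" where
  "C2_on_interval l r w w' \<longleftrightarrow>
     (\<exists>w''. (\<forall>x\<in>{l..r}. (w has_real_derivative w' x) (at x within {l..r})) \<and>
            (\<forall>x\<in>{l..r}. (w' has_real_derivative w'' x) (at x within {l..r})) \<and>
            continuous_on {l..r} w'')"

definition admissible_init :: "real \<Rightarrow> (real \<Rightarrow> real) \<Rightarrow> bool" where
  "admissible_init s0 w0 \<longleftrightarrow>
     (\<exists>w0'. C2_on_interval 0 s0 w0 w0' \<and> w0' 0 = 0) \<and>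
     (\<forall>x. 0 \<le> x \<and> x < s0 \<longrightarrow> w0 x > 0) \<and>
     (\<forall>x\<ge>s0. w0 x = 0)"

definition fb_component ::
  "real \<Rightarrow> real \<Rightarrow> (real \<Rightarrow> real \<Rightarrow> real) \<Rightarrow> real \<Rightarrow> (real \<Rightarrow> real)
   \<Rightarrow> (real \<Rightarrow> real \<Rightarrow> real) \<Rightarrow> (real \<Rightarrow> real) \<Rightarrow> bool" where
  "fb_component D m F s0 w0 w s \<longleftrightarrow>
     (\<exists>wt wx wxx s'.
        continuous_on {p. fst p \<ge> 0 \<and> snd p \<ge> 0} (\<lambda>p. w (fst p) (snd p)) \<and>
        continuous_on {0..} s \<and>
        (\<forall>t>0. (s has_real_derivative s' t) (at t)) \<and> continuous_on {0<..} s' \<and>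
        (\<forall>t>0. \<forall>x\<in>{0..s t}. ((\<lambda>y. w t y) has_real_derivative wx t x) (at x within {0..s t})) \<and>
        continuous_on {p. fst p > 0 \<and> 0 \<le> snd p \<and> snd p \<le> s (fst p)} (\<lambda>p. wx (fst p) (snd p)) \<and>
        (\<forall>t>0. \<forall>x. 0 < x \<and> x < s t \<longrightarrow>
            ((\<lambda>y. wx t y) has_real_derivative wxx t x) (at x) \<and>
            ((\<lambda>\<tau>. w \<tau> x) has_real_derivative wt t x) (at t)) \<and>
        continuous_on {p. fst p > 0 \<and> 0 < snd p \<and> snd p < s (fst p)} (\<lambda>p. wt (fst p) (snd p)) \<and>
        continuous_on {p. fst p > 0 \<and> 0 < snd p \<and> snd p < s (fst p)} (\<lambda>p. wxx (fst p) (snd p)) \<and>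
        (\<forall>t>0. \<forall>x. 0 < x \<and> x < s t \<longrightarrow> wt t x - D * wxx t x = F t x) \<and>
        (\<forall>t>0. wx t 0 = 0) \<and>
        (\<forall>t>0. s' t = - m * wx t (s t)) \<and>
        (\<forall>t\<ge>0. \<forall>x\<ge>s t. w t x = 0) \<and>
        (\<forall>x\<ge>0. w 0 x = w0 x) \<and>
        s 0 = s0)"

definition fb_solution ::
  "real \<Rightarrow> real \<Rightarrow> real \<Rightarrow> real \<Rightarrow> real \<Rightarrow> real \<Rightarrow> real \<Rightarrow> real
   \<Rightarrow> (real \<Rightarrow> real) \<Rightarrow> (real \<Rightarrow> real)
   \<Rightarrow> (real \<Rightarrow> real \<Rightarrow> real) \<Rightarrow> (real \<Rightarrow> real \<Rightarrow> real) \<Rightarrow> (real \<Rightarrow> real) \<Rightarrow> (real \<Rightarrow> real) \<Rightarrow> bool" where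
  "fb_solution a b c d \<beta> \<mu> g0 h0 u0 v0 u v g h \<longleftrightarrow>
     fb_component d \<beta> (\<lambda>t x. u t x * (a - u t x - b * v t x)) g0 u0 u g \<and>
     fb_component 1 \<mu> (\<lambda>t x. v t x * (1 - v t x + c * u t x)) h0 v0 v h"

end

theory Submission
  imports Defs
begin

text \<open>
  Write \<open>k\<close>, \<open>l\<close> for the semi-wave speeds of the prey and of the predator, so \<open>k < l\<close>. The prey is
  a subsolution of its logistic free boundary problem, hence \<open>(1 + \<delta>) p(G(t) - x)\<close>, with \<open>p\<close> its
  semi-wave and \<open>G' = (1 + 2\<delta>) k\<close>, is eventually a supersolution and \<open>g(t) < G(t)\<close>. The predator is a
  supersolution; since \<open>h\<close> is unbounded, comparison with multiples of \<open>cos (\<pi>x/2R)\<close> gives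
  \<open>v(t,0) > 1 - \<delta>\<close> eventually, and then \<open>(1 - \<delta>) q(H(t) - x)\<close> with \<open>H' = (1 - 2\<delta>) l\<close> is a
  subsolution with a Dirichlet condition at the origin. As \<open>H - G\<close> tends to infinity, \<open>v\<close> exceeds
  \<open>a/b\<close> uniformly on \<open>[0, g(t)]\<close> for large \<open>t\<close>, so \<open>u\<close> is damped exponentially, and a supersolution
  whose front converges stops \<open>g\<close>.

  The speeds are meaningful because semi-waves exist for exactly one speed. In the phase plane
  \<open>p = q'\<close> is a function of \<open>q\<close>; one shoots from \<open>p(0) = k/\<nu>\<close> and takes the least speed for which
  \<open>p\<close> stays nonnegative up to \<open>q = \<theta>\<close>. The gap between the phase curves of two speeds grows, so at
  most one of them can end at \<open>(\<theta>, 0)\<close>.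
\<close>

section \<open>Semi-waves\<close>

lemma nondecreasing_while_positive:
  fixes f :: "real \<Rightarrow> real"
  assumes "a \<le> b" "continuous_on {a..b} f" "f a > 0"
    and deriv: "\<And>x. a < x \<Longrightarrow> x < b \<Longrightarrow> f x > 0 \<Longrightarrow> \<exists>y\<ge>0. (f has_real_derivative y) (at x)"
  shows "f a \<le> f b"
proof (cases "\<exists>s\<in>{a..b}. f s \<le> 0")
  case False
  show ?thesis
  proof (rule DERIV_nonneg_imp_increasing_open[OF assms(1) _ assms(2)])
    fix x assume x: "a < x" "x < b"
    then have "f x > 0" using False by (meson atLeastAtMost_iff less_imp_le not_le)
    with x show "\<exists>y. (f has_real_derivative y) (at x) \<and> 0 \<le> y" using deriv[of x] by auto
  qed
next
  case True
  let ?A = "{s\<in>{a..b}. f s \<le> 0}"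
  have "?A = {a..b} \<inter> f -` {..0}" by auto
  then have "closed ?A"
    using continuous_closed_preimage[OF assms(2) closed_atLeastAtMost, of "{..0}"] by simp
  moreover have "?A = {a..b} \<inter> ?A" by auto
  ultimately have "compact ?A"
    using compact_Int_closed[of "{a..b}" ?A] by simp
  moreover have "?A \<noteq> {}" using True by auto
  ultimately obtain c where c: "c \<in> ?A" "\<And>s. s \<in> ?A \<Longrightarrow> c \<le> s"
    using compact_attains_inf[of ?A] by blast
  have pos: "f s > 0" if "a \<le> s" "s < c" for s
    using c(1) c(2)[of s] that by force
  have "f a \<le> f c"
  proof (rule DERIV_nonneg_imp_increasing_open[of a c f])
    show "a \<le> c" using c by auto
    show "continuous_on {a..c} f" using assms(2) by (rule continuous_on_subset) (use c in auto)
    show "\<exists>y. (f has_real_derivative y) (at x) \<and> 0 \<le> y" if "a < x" "x < c" for x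
      using deriv[of x] pos[of x] that c(1) by auto
  qed
  with c(1) assms(3) show ?thesis by auto
qed

lemma semi_waveE:
  assumes "semi_wave \<nu> D \<theta> k q"
  obtains q' q'' where "\<And>x. x \<ge> 0 \<Longrightarrow> (q has_real_derivative q' x) (at x within {0..})"
    "\<And>x. x > 0 \<Longrightarrow> (q has_real_derivative q' x) (at x)"
    "continuous_on {0..} q" "continuous_on {0..} q'"
    "\<And>x. x > 0 \<Longrightarrow> (q' has_real_derivative q'' x) (at x)"
    "\<And>x. x > 0 \<Longrightarrow> D * q'' x - k * q' x + q x * (\<theta> - q x) = 0"
    "q 0 = 0" "q' 0 = k / \<nu>" "(q \<longlongrightarrow> \<theta>) at_top" "\<And>x. x > 0 \<Longrightarrow> q' x > 0"
    "\<And>x y. 0 \<le> x \<Longrightarrow> x < y \<Longrightarrow> q x < q y" "\<And>x. 0 \<le> x \<Longrightarrow> q x < \<theta>"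
proof -
  obtain q' q'' where dq: "\<And>x. x \<ge> 0 \<Longrightarrow> (q has_real_derivative q' x) (at x within {0..})"
    and cq': "continuous_on {0..} q'"
    and dq': "\<And>x. x > 0 \<Longrightarrow> (q' has_real_derivative q'' x) (at x)"
    and ode: "\<And>x. x > 0 \<Longrightarrow> D * q'' x - k * q' x + q x * (\<theta> - q x) = 0"
    and q0: "q 0 = 0" "q' 0 = k / \<nu>" and lim: "(q \<longlongrightarrow> \<theta>) at_top" and q'pos: "\<And>x. x > 0 \<Longrightarrow> q' x > 0"
    using assms(1) unfolding semi_wave_def by blast
  have cq: "continuous_on {0..} q"
    using dq DERIV_continuous_on by blast
  have dq1: "(q has_real_derivative q' x) (at x)" if "x > 0" for x
    using dq[of x] that at_within_interior[of x "{0..}"] by (simp add: interior_real_atLeast)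
  have mono: "q x < q y" if "0 \<le> x" "x < y" for x y
  proof (rule DERIV_pos_imp_increasing_open[OF that(2)])
    show "continuous_on {x..y} q" using cq by (rule continuous_on_subset) (use that in auto)
    show "\<exists>d. (q has_real_derivative d) (at z) \<and> 0 < d" if "x < z" "z < y" for z
      using dq1[of z] q'pos[of z] that \<open>0 \<le> x\<close> by force
  qed
  have lt: "q x < \<theta>" if "0 \<le> x" for x
  proof -
    have "q x < q (x+1)" using mono that by auto
    also have "q (x+1) \<le> \<theta>"
    proof (rule tendsto_lowerbound[OF lim])
      show "\<forall>\<^sub>F y in at_top. q (x+1) \<le> q y"
        using eventually_ge_at_top[of "x+1"]
      proof eventually_elim
        case (elim y)
        then show ?case using mono[of "x+1" y] that by (cases "y = x+1") auto
      qed
    qed simp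
    finally show ?thesis .
  qed
  show thesis by (rule that[OF dq dq1 cq cq' dq' ode q0 lim q'pos mono lt])
qed

lemma semi_wave_phase_curve:
  assumes "semi_wave \<nu> D \<theta> k q" "D > 0"
  obtains P where "P 0 = k / \<nu>" "\<And>b. b < \<theta> \<Longrightarrow> continuous_on {0..b} P"
    "\<And>s. 0 < s \<Longrightarrow> s < \<theta> \<Longrightarrow> P s > 0"
    "\<And>s. 0 < s \<Longrightarrow> s < \<theta> \<Longrightarrow> (P has_real_derivative (k - s * (\<theta> - s) / P s) / D) (at s)"
    "\<And>x. 0 < x \<Longrightarrow> 0 < q x \<and> q x < \<theta> \<and> (q has_real_derivative P (q x)) (at x)"
    "continuous_on {0..} q"
proof -
  obtain q' q'' where dq1: "\<And>x. x > 0 \<Longrightarrow> (q has_real_derivative q' x) (at x)"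
    and cq: "continuous_on {0..} q" and cq': "continuous_on {0..} q'"
    and dq': "\<And>x. x > 0 \<Longrightarrow> (q' has_real_derivative q'' x) (at x)"
    and ode: "\<And>x. x > 0 \<Longrightarrow> D * q'' x - k * q' x + q x * (\<theta> - q x) = 0"
    and q0: "q 0 = 0" "q' 0 = k / \<nu>" and lim: "(q \<longlongrightarrow> \<theta>) at_top" and q'pos: "\<And>x. x > 0 \<Longrightarrow> q' x > 0"
    and mono: "\<And>x y. 0 \<le> x \<Longrightarrow> x < y \<Longrightarrow> q x < q y" and lt: "\<And>x. 0 \<le> x \<Longrightarrow> q x < \<theta>"
    by (rule semi_waveE[OF assms(1)]) blast
  have inj: "inj_on q {0..}"
    using mono by (intro linorder_inj_onI) (fastforce)+
  define r where "r = the_inv_into {0..} q"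
  have rq: "r (q x) = x" if "0 \<le> x" for x
    unfolding r_def using the_inv_into_f_f[OF inj] that by auto
  have surj: "\<exists>x\<ge>0. x \<le> B \<and> q x = s" if "0 \<le> s" "s \<le> q B" "0 \<le> B" for s B
    using IVT'[of q 0 s B] that q0 continuous_on_subset[OF cq, of "{0..B}"] by auto
  have big: "\<exists>B>0. s < q B" if "s < \<theta>" for s
  proof -
    have "\<forall>\<^sub>F y in at_top. s < q y \<and> 0 < y" 
      using order_tendstoD(1)[OF lim that] eventually_gt_at_top[of 0] by eventually_elim auto
    then show ?thesis using eventually_happens[of _ "at_top::real filter"] by force
  qed
  have cr: "continuous_on {0..b} r" if b: "b < \<theta>" for b
  proof -
    obtain B where B: "B > 0" "b < q B" using big[OF b] by auto
    have "continuous_on (q ` {0..B}) r"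
      by (rule continuous_on_inv) (use rq continuous_on_subset[OF cq, of "{0..B}"] in auto)
    moreover have "{0..b} \<subseteq> q ` {0..B}" using surj[of _ B] B by force
    ultimately show ?thesis using continuous_on_subset by blast
  qed
  have rpos: "r s > 0 \<and> q (r s) = s" if s: "0 < s" "s < \<theta>" for s
  proof -
    obtain B where B: "B > 0" "s < q B" using big[OF s(2)] by auto
    obtain x where "x \<ge> 0" "q x = s" using surj[of s B] s B by auto
    then show ?thesis using rq[of x] s q0 by (cases "x = 0") auto
  qed
  have r0: "r 0 = 0" using rq[of 0] q0 by simp
  show thesis
  proof (rule that[of "\<lambda>s. q' (r s)"])
    show "q' (r 0) = k / \<nu>" using r0 q0 by simp
    show "continuous_on {0..b} (\<lambda>s. q' (r s))" if "b < \<theta>" for b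
    proof (rule continuous_on_compose2[OF cq' cr[OF that]])
      show "r ` {0..b} \<subseteq> {0..}" using rpos r0 that by (smt (verit) atLeastAtMost_iff atLeast_iff image_subset_iff)
    qed
    show "q' (r s) > 0" if "0 < s" "s < \<theta>" for s using rpos q'pos that by blast
    show "((\<lambda>s. q' (r s)) has_real_derivative (k - s * (\<theta> - s) / q' (r s)) / D) (at s)" if s: "0 < s" "s < \<theta>" for s
    proof -
      have rs: "r s > 0" "q (r s) = s" using rpos[OF s] by auto
      obtain b where b: "s < b" "b < \<theta>" using s dense by blast
      have "isCont r s" 
        using continuous_on_interior[OF cr[OF b(2)]] s b by simp
      then have "(r has_real_derivative inverse (q' (r s))) (at s)"
        by (intro DERIV_inverse_function[of q _ r s 0 b])
          (use dq1[OF rs(1)] q'pos[OF rs(1)] s b rpos in auto)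
      then have "((\<lambda>s. q' (r s)) has_real_derivative q'' (r s) * inverse (q' (r s))) (at s)"
        by (rule DERIV_chain2[where f=q' and g=r, OF dq'[OF rs(1)]])
      moreover have "q'' (r s) * inverse (q' (r s)) = (k - s * (\<theta> - s) / q' (r s)) / D"
        using ode[OF rs(1)] q'pos[OF rs(1)] \<open>D > 0\<close> rs(2) by (simp add: field_simps)
      ultimately show ?thesis by simp
    qed
    show "0 < q x \<and> q x < \<theta> \<and> (q has_real_derivative q' (r (q x))) (at x)" if "0 < x" for x
      using mono[of 0 x] lt[of x] rq[of x] dq1[of x] q0 that by simp
    show "continuous_on {0..} q" by (rule cq)
  qed
qed

lemma semi_wave_speed_not_less:
  assumes "semi_wave \<nu> D \<theta> k1 q1" "semi_wave \<nu> D \<theta> k2 q2" "D > 0" "\<nu> > 0"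
  shows "\<not> k1 < k2"
proof
  assume "k1 < k2"
  obtain P1 where P1: "P1 0 = k1 / \<nu>" "\<And>b. b < \<theta> \<Longrightarrow> continuous_on {0..b} P1"
    "\<And>s. 0 < s \<Longrightarrow> s < \<theta> \<Longrightarrow> P1 s > 0"
    "\<And>s. 0 < s \<Longrightarrow> s < \<theta> \<Longrightarrow> (P1 has_real_derivative (k1 - s * (\<theta> - s) / P1 s) / D) (at s)"
    using semi_wave_phase_curve[OF assms(1,3)] by metis
  obtain P2 where P2: "P2 0 = k2 / \<nu>" "\<And>b. b < \<theta> \<Longrightarrow> continuous_on {0..b} P2"
    "\<And>s. 0 < s \<Longrightarrow> s < \<theta> \<Longrightarrow> P2 s > 0"
    "\<And>s. 0 < s \<Longrightarrow> s < \<theta> \<Longrightarrow> (P2 has_real_derivative (k2 - s * (\<theta> - s) / P2 s) / D) (at s)"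
    and q2: "\<And>x. 0 < x \<Longrightarrow> 0 < q2 x \<and> q2 x < \<theta> \<and> (q2 has_real_derivative P2 (q2 x)) (at x)"
    and cq2: "continuous_on {0..} q2"
    using semi_wave_phase_curve[OF assms(2,3)] by metis
  define \<delta> where "\<delta> = (k2 - k1) / \<nu>"
  have \<delta>: "\<delta> > 0" using assms \<open>k1 < k2\<close> by (simp add: \<delta>_def)
  have gap: "\<delta> \<le> P2 s" if s: "0 < s" "s < \<theta>" for s
  proof -
    have "P2 0 - P1 0 \<le> P2 s - P1 s"
    proof (rule nondecreasing_while_positive[where f="\<lambda>s. P2 s - P1 s"])
      show "0 \<le> s" using s by simp
      show "continuous_on {0..s} (\<lambda>s. P2 s - P1 s)"
        using P1(2)[of s] P2(2)[of s] s by (intro continuous_intros) auto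
      show "0 < P2 0 - P1 0" using \<delta> P1(1) P2(1) by (simp add: \<delta>_def diff_divide_distrib)
      fix x assume x: "0 < x" "x < s" "0 < P2 x - P1 x"
      have p: "P1 x > 0" "P2 x > P1 x" using P1(3)[of x] x s by auto
      have "x * (\<theta> - x) / P2 x \<le> x * (\<theta> - x) / P1 x"
        using p x s by (intro divide_left_mono) auto
      then have "(k1 - x * (\<theta> - x) / P1 x) / D \<le> (k2 - x * (\<theta> - x) / P2 x) / D"
        using assms \<open>k1 < k2\<close> by (intro divide_right_mono) auto
      then show "\<exists>y\<ge>0. ((\<lambda>s. P2 s - P1 s) has_real_derivative y) (at x)"
        using DERIV_diff[OF P2(4)[of x] P1(4)[of x]] x s
        by (intro exI[of _ "(k2 - x * (\<theta> - x) / P2 x) / D - (k1 - x * (\<theta> - x) / P1 x) / D"]) simp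
    qed
    then show ?thesis using P1(1) P2(1) P1(3)[OF s] by (simp add: \<delta>_def diff_divide_distrib)
  qed
  define B where "B = \<theta> / \<delta> + 1"
  have "\<theta> > 0" using q2[of 1] by linarith
  then have "B > 0" using \<delta> by (simp add: B_def add_pos_pos)
  have "q2 0 - \<delta> * 0 \<le> q2 B - \<delta> * B"
  proof (rule DERIV_nonneg_imp_increasing_open[of 0 B "\<lambda>x. q2 x - \<delta> * x"])
    show "continuous_on {0..B} (\<lambda>x. q2 x - \<delta> * x)"
      using continuous_on_subset[OF cq2, of "{0..B}"] by (intro continuous_intros) auto
    fix x assume "0 < x" "x < B"
    then show "\<exists>y. ((\<lambda>x. q2 x - \<delta> * x) has_real_derivative y) (at x) \<and> 0 \<le> y"
      using q2[of x] gap[of "q2 x"]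
      by (intro exI[of _ "P2 (q2 x) - \<delta>"]) (auto intro!: derivative_eq_intros)
  qed (use \<open>B > 0\<close> in auto)
  moreover have "q2 0 = 0" using assms(2) unfolding semi_wave_def by blast
  moreover have "\<delta> * B = \<theta> + \<delta>" using \<delta> by (simp add: B_def field_simps)
  ultimately show False using q2[OF \<open>B > 0\<close>] \<delta> by simp
qed

text \<open>
  The unknown is \<open>Y = p\<^sup>2/2\<close> as a function of \<open>s = q\<close>, for which the equation reads
  \<open>D Y' = k \<surd>(2Y) - s(\<theta> - s)\<close>. Its right-hand side is increasing in \<open>Y\<close>, so Picard iteration started
  from the constant upper solution \<open>M\<close> decreases to the largest solution; no Lipschitz condition is
  needed. The square root is cut off at \<open>0\<close> so that solutions exist on all of \<open>[0, \<theta>]\<close>.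
\<close>

locale shooting =
  fixes \<nu> D \<theta> M :: real
  assumes \<nu>_pos: "0 < \<nu>" and D_pos: "0 < D" and \<theta>_pos: "0 < \<theta>" and M_pos: "0 < M"
    and M_upper: "\<And>k. 0 \<le> k \<Longrightarrow> k \<le> 2 * sqrt (\<theta> * D) \<Longrightarrow> (k/\<nu>)\<^sup>2/2 + k * \<theta> * sqrt (2*M) / D \<le> M"
    and M_linear: "\<And>k. 0 \<le> k \<Longrightarrow> k \<le> 2 * sqrt (\<theta> * D) \<Longrightarrow> (k/\<nu> + k * \<theta> / (2*D))\<^sup>2/2 \<le> M"
begin

abbreviation kmax :: real where "kmax \<equiv> 2 * sqrt (\<theta> * D)"

definition rate :: "real \<Rightarrow> real \<Rightarrow> real \<Rightarrow> real" where
  "rate k s y = (k * sqrt (2 * max 0 y) - s * (\<theta> - s)) / D"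

definition picard :: "real \<Rightarrow> (real \<Rightarrow> real) \<Rightarrow> real \<Rightarrow> real" where
  "picard k Y s = (k/\<nu>)\<^sup>2/2 + integral {0..s} (\<lambda>r. rate k r (Y r))"

definition lower_sol :: "real \<Rightarrow> (real \<Rightarrow> real) \<Rightarrow> bool" where
  "lower_sol k V \<longleftrightarrow> continuous_on {0..\<theta>} V \<and> (\<forall>s\<in>{0..\<theta>}. V s \<le> M \<and> V s \<le> picard k V s)"

definition sol :: "real \<Rightarrow> (real \<Rightarrow> real) \<Rightarrow> bool" where
  "sol k Y \<longleftrightarrow> continuous_on {0..\<theta>} Y \<and> (\<forall>s\<in>{0..\<theta>}. Y s \<le> M \<and> Y s = picard k Y s)"

definition maximal_sol :: "real \<Rightarrow> (real \<Rightarrow> real) \<Rightarrow> bool" where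
  "maximal_sol k Y \<longleftrightarrow> sol k Y \<and> (\<forall>V. lower_sol k V \<longrightarrow> (\<forall>s\<in>{0..\<theta>}. V s \<le> Y s))"

lemma kmax_pos: "kmax > 0"
  using D_pos \<theta>_pos by simp

lemma rate_mono: "0 \<le> k \<Longrightarrow> k \<le> l \<Longrightarrow> y \<le> z \<Longrightarrow> rate k s y \<le> rate l s z"
  unfolding rate_def using D_pos
  by (intro divide_right_mono diff_right_mono mult_mono real_sqrt_le_mono) auto

lemma continuous_rate:
  "continuous_on {0..\<theta>} Y \<Longrightarrow> continuous_on {0..\<theta>} (\<lambda>r. rate k r (Y r))"
  unfolding rate_def using D_pos by (intro continuous_intros) auto

lemma integrable_rate:
  assumes "(\<lambda>r. rate k r (Y r)) integrable_on {0..\<theta>}" "s \<le> \<theta>"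
  shows "(\<lambda>r. rate k r (Y r)) integrable_on {0..s}"
  using integrable_on_subinterval[OF assms(1), of 0 s] assms(2) by auto

lemma integrable_rate_cont:
  "continuous_on {0..\<theta>} Y \<Longrightarrow> s \<le> \<theta> \<Longrightarrow> (\<lambda>r. rate k r (Y r)) integrable_on {0..s}"
  using integrable_rate integrable_continuous_interval continuous_rate by blast

lemma continuous_picard:
  assumes "(\<lambda>r. rate k r (Y r)) integrable_on {0..\<theta>}"
  shows "continuous_on {0..\<theta>} (picard k Y)"
  unfolding picard_def using indefinite_integral_continuous_1[OF assms] by (intro continuous_intros)

lemma picard_mono:
  assumes "continuous_on {0..\<theta>} Y" "continuous_on {0..\<theta>} Z" "\<And>s. s \<in> {0..\<theta>} \<Longrightarrow> Y s \<le> Z s"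
    "0 \<le> k" "k \<le> l" "s \<in> {0..\<theta>}"
  shows "picard k Y s \<le> picard l Z s"
proof -
  have "(k/\<nu>)\<^sup>2 \<le> (l/\<nu>)\<^sup>2" 
    using \<nu>_pos assms by (intro power_mono divide_right_mono) auto
  moreover have "integral {0..s} (\<lambda>r. rate k r (Y r)) \<le> integral {0..s} (\<lambda>r. rate l r (Z r))"
    using assms by (intro integral_le integrable_rate_cont rate_mono) auto
  ultimately show ?thesis unfolding picard_def by auto
qed

lemma picard_M:
  assumes "0 \<le> k" "k \<le> kmax" "s \<in> {0..\<theta>}"
  shows "picard k (\<lambda>_. M) s \<le> M"
proof -
  have "integral {0..s} (\<lambda>r. rate k r M) \<le> integral {0..s} (\<lambda>r. k * sqrt (2*M) / D)"
  proof (rule integral_le)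
    show "(\<lambda>r. rate k r M) integrable_on {0..s}" using assms integrable_rate_cont[of "\<lambda>_. M"] by auto
    show "rate k r M \<le> k * sqrt (2*M) / D" if "r \<in> {0..s}" for r
      unfolding rate_def using D_pos M_pos that assms by (intro divide_right_mono) auto
  qed auto
  also have "\<dots> = s * (k * sqrt (2*M) / D)" using assms by simp
  also have "\<dots> \<le> \<theta> * (k * sqrt (2*M) / D)" 
    using assms D_pos M_pos by (intro mult_right_mono) auto
  finally show ?thesis using M_upper[of k] assms unfolding picard_def by (simp add: mult_ac)
qed

lemma abs_rate_le:
  assumes "\<bar>k\<bar> \<le> K" "y \<le> M" "r \<in> {0..\<theta>}"
  shows "\<bar>rate k r y\<bar> \<le> (K * sqrt (2*M) + \<theta> * \<theta>) / D"
proof -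
  have "\<bar>k * sqrt (2 * max 0 y)\<bar> \<le> K * sqrt (2*M)"
    unfolding abs_mult using assms M_pos by (intro mult_mono) auto
  moreover have "\<bar>r * (\<theta> - r)\<bar> \<le> \<theta> * \<theta>"
    unfolding abs_mult using assms by (intro mult_mono) auto
  ultimately have "\<bar>k * sqrt (2 * max 0 y) - r * (\<theta> - r)\<bar> \<le> K * sqrt (2*M) + \<theta> * \<theta>" by linarith
  then show ?thesis unfolding rate_def abs_divide using D_pos by (simp add: divide_right_mono)
qed

lemma picard_limit:
  assumes cont: "\<And>n. continuous_on {0..\<theta>} (Y n)" and le: "\<And>n s. s \<in> {0..\<theta>} \<Longrightarrow> Y n s \<le> M"
    and lim: "\<And>s. s \<in> {0..\<theta>} \<Longrightarrow> (\<lambda>n. Y n s) \<longlonglongrightarrow> Z s"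
    and k: "l \<longlonglongrightarrow> k" "\<And>n. \<bar>l n\<bar> \<le> K"
  shows "continuous_on {0..\<theta>} (picard k Z)"
    "s \<in> {0..\<theta>} \<Longrightarrow> (\<lambda>n. picard (l n) (Y n) s) \<longlonglongrightarrow> picard k Z s"
proof -
  have ptw: "(\<lambda>n. rate (l n) r (Y n r)) \<longlonglongrightarrow> rate k r (Z r)" if "r \<in> {0..\<theta>}" for r
    unfolding rate_def using D_pos lim[OF that] k(1) by (intro tendsto_intros) auto
  have dom: "(\<lambda>r. rate k r (Z r)) integrable_on {0..s} \<and>
    (\<lambda>n. integral {0..s} (\<lambda>r. rate (l n) r (Y n r))) \<longlonglongrightarrow> integral {0..s} (\<lambda>r. rate k r (Z r))"
    if s: "s \<in> {0..\<theta>}" for s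
  proof (intro conjI)
    let ?h = "\<lambda>_::real. (K * sqrt (2*M) + \<theta> * \<theta>) / D"
    have 1: "(\<lambda>r. rate (l n) r (Y n r)) integrable_on {0..s}" for n
      using integrable_rate_cont[OF cont] s by auto
    have 2: "?h integrable_on {0..s}" by auto
    have 3: "norm (rate (l n) r (Y n r)) \<le> ?h r" if "r \<in> {0..s}" for n r
      using abs_rate_le[of "l n" K "Y n r" r] k(2) le[of r n] that s by auto
    show "(\<lambda>r. rate k r (Z r)) integrable_on {0..s}"
      by (rule dominated_convergence(1)[OF 1 2 3 ptw]) (use s in auto)
    show "(\<lambda>n. integral {0..s} (\<lambda>r. rate (l n) r (Y n r))) \<longlonglongrightarrow> integral {0..s} (\<lambda>r. rate k r (Z r))"
      by (rule dominated_convergence(2)[OF 1 2 3 ptw]) (use s in auto)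
  qed
  show "continuous_on {0..\<theta>} (picard k Z)"
    using continuous_picard dom[of \<theta>] \<theta>_pos by auto
  show "(\<lambda>n. picard (l n) (Y n) s) \<longlonglongrightarrow> picard k Z s" if "s \<in> {0..\<theta>}"
    unfolding picard_def using dom[OF that] k(1) \<nu>_pos by (intro tendsto_intros) auto
qed

lemma picard_ge:
  assumes "continuous_on {0..\<theta>} Y" "\<And>s. s \<in> {0..\<theta>} \<Longrightarrow> Y s \<le> M" "0 \<le> k" "s \<in> {0..\<theta>}"
  shows "- \<theta> * ((k * sqrt (2*M) + \<theta> * \<theta>) / D) \<le> picard k Y s"
proof -
  let ?B = "(k * sqrt (2*M) + \<theta> * \<theta>) / D"
  have B: "?B \<ge> 0" using assms M_pos D_pos \<theta>_pos by auto
  have "integral {0..s} (\<lambda>r. - ?B) \<le> integral {0..s} (\<lambda>r. rate k r (Y r))"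
  proof (rule integral_le)
    show "(\<lambda>r. rate k r (Y r)) integrable_on {0..s}" using integrable_rate_cont assms by auto
    show "- ?B \<le> rate k r (Y r)" if "r \<in> {0..s}" for r
      using abs_rate_le[of k k "Y r" r] assms that by fastforce
  qed auto
  moreover have "s * ?B \<le> \<theta> * ?B" using assms B by (intro mult_right_mono) auto
  moreover have "integral {0..s} (\<lambda>r. - ?B) = - (s * ?B)" using assms(4) by simp
  moreover have "0 \<le> (k/\<nu>)\<^sup>2/2" by simp
  ultimately show ?thesis unfolding picard_def by linarith
qed

lemma ex_maximal_sol:
  assumes k: "0 \<le> k" "k \<le> kmax"
  shows "\<exists>Y. maximal_sol k Y"
proof -
  define Y where "Y n = (picard k ^^ n) (\<lambda>_. M)" for n
  have Y0: "Y 0 = (\<lambda>_. M)" and YS: "Y (Suc n) = picard k (Y n)" for n by (auto simp: Y_def)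
  have step: "continuous_on {0..\<theta>} (Y n) \<and> (\<forall>s\<in>{0..\<theta>}. Y n s \<le> M)" for n
  proof (induction n)
    case (Suc n)
    have "picard k (Y n) s \<le> M" if "s \<in> {0..\<theta>}" for s
      using picard_mono[of "Y n" "\<lambda>_. M" k k s] Suc picard_M[of k s] k that by force
    then show ?case using Suc continuous_picard[of k "Y n"] integrable_rate_cont[of "Y n" \<theta>]
      unfolding YS by auto
  qed (auto simp: Y0)
  have dec: "\<forall>s\<in>{0..\<theta>}. Y (Suc n) s \<le> Y n s" for n
  proof (induction n)
    case 0
    show ?case using picard_M k by (simp add: YS Y0)
  next
    case (Suc n)
    then have "picard k (Y (Suc n)) s \<le> picard k (Y n) s" if "s \<in> {0..\<theta>}" for s
      using picard_mono[of "Y (Suc n)" "Y n" k k s] step k that by blast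
    then show ?case using YS by metis
  qed
  have low: "\<forall>s\<in>{0..\<theta>}. V s \<le> Y n s" if V: "lower_sol k V" for V n
  proof (induction n)
    case 0
    then show ?case using V by (auto simp: Y0 lower_sol_def)
  next
    case (Suc n)
    then show ?case using picard_mono[of V "Y n" k k] step k V
      unfolding YS lower_sol_def by (meson order.trans order_refl)
  qed
  have conv: "convergent (\<lambda>n. Y n s)" if s: "s \<in> {0..\<theta>}" for s
  proof -
    have "decseq (\<lambda>n. Y n s)" using dec s by (auto simp: decseq_Suc_iff)
    moreover have "min M (- \<theta> * ((k * sqrt (2*M) + \<theta> * \<theta>) / D)) \<le> Y n s" for n
      using picard_ge[of "Y (n-1)" k s] step k s by (cases n) (auto simp: Y0 YS min_le_iff_disj)
    ultimately show ?thesis using decseq_convergent convergentI by metis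
  qed
  define Z where "Z s = lim (\<lambda>n. Y n s)" for s
  have Z: "(\<lambda>n. Y n s) \<longlonglongrightarrow> Z s" if "s \<in> {0..\<theta>}" for s
    using conv[OF that] by (simp add: Z_def convergent_LIMSEQ_iff)
  have lim: "continuous_on {0..\<theta>} (picard k Z)"
    "\<And>s. s \<in> {0..\<theta>} \<Longrightarrow> (\<lambda>n. picard k (Y n) s) \<longlonglongrightarrow> picard k Z s"
    using picard_limit[of Y Z "\<lambda>_. k" k k] step Z k by auto
  have eq: "Z s = picard k Z s" if "s \<in> {0..\<theta>}" for s
    using lim(2)[OF that] LIMSEQ_Suc[OF Z[OF that]] LIMSEQ_unique unfolding YS by blast
  have cZ: "continuous_on {0..\<theta>} Z"
    by (rule continuous_on_eq[OF lim(1)]) (simp add: eq[symmetric])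
  have "Z s \<le> M" if "s \<in> {0..\<theta>}" for s
    using LIMSEQ_le_const2[OF Z[OF that]] step that by blast
  then have "sol k Z" using cZ eq by (auto simp: sol_def)
  moreover have "V s \<le> Z s" if "lower_sol k V" "s \<in> {0..\<theta>}" for V s
    using LIMSEQ_le_const[OF Z[OF that(2)]] low[OF that(1)] that(2) by blast
  ultimately show ?thesis unfolding maximal_sol_def by blast
qed

lemma sol_deriv:
  assumes "sol k Y" "s \<in> {0..\<theta>}"
  shows "(Y has_real_derivative rate k s (Y s)) (at s within {0..\<theta>})"
proof -
  have "continuous_on {0..\<theta>} Y" using assms unfolding sol_def by auto
  then have "((\<lambda>s. integral {0..s} (\<lambda>r. rate k r (Y r))) has_real_derivative rate k s (Y s)) (at s within {0..\<theta>})"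
    using continuous_rate assms(2) by (intro integral_has_real_derivative)
  then have "(picard k Y has_real_derivative rate k s (Y s)) (at s within {0..\<theta>})"
    unfolding picard_def by (auto intro!: derivative_eq_intros)
  then show ?thesis
    by (rule has_field_derivative_transform_within[of _ _ _ _ 1]) (use assms in \<open>auto simp: sol_def\<close>)
qed

lemma sol_0: "sol k Y \<Longrightarrow> Y 0 = (k/\<nu>)\<^sup>2/2"
  using \<theta>_pos by (auto simp: sol_def picard_def)

lemma lower_solI:
  assumes V0: "V 0 \<le> (k/\<nu>)\<^sup>2/2" and cont: "continuous_on {0..\<theta>} V"
    and deriv: "\<And>s. 0 < s \<Longrightarrow> s < \<theta> \<Longrightarrow> (V has_real_derivative V' s) (at s) \<and> V' s \<le> rate k s (V s)"
    and le: "\<And>s. s \<in> {0..\<theta>} \<Longrightarrow> V s \<le> M"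
  shows "lower_sol k V"
proof -
  have "V s \<le> picard k V s" if s: "s \<in> {0..\<theta>}" for s
  proof -
    have "picard k V 0 - V 0 \<le> picard k V s - V s"
    proof (rule DERIV_nonneg_imp_increasing_open[of 0 s "\<lambda>s. picard k V s - V s"])
      have "continuous_on {0..\<theta>} (picard k V)" using continuous_picard integrable_rate_cont[OF cont] by auto
      with cont show "continuous_on {0..s} (\<lambda>s. picard k V s - V s)"
        using s by (intro continuous_intros) (auto elim: continuous_on_subset)
      fix x assume x: "0 < x" "x < s"
      have "((\<lambda>s. integral {0..s} (\<lambda>r. rate k r (V r))) has_real_derivative rate k x (V x)) (at x within {0..\<theta>})"
        using continuous_rate[OF cont] s x by (intro integral_has_real_derivative) auto
      then have "((\<lambda>s. integral {0..s} (\<lambda>r. rate k r (V r))) has_real_derivative rate k x (V x)) (at x)"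
        using at_within_Icc_at[of 0 x \<theta>] x s by simp
      then have "(picard k V has_real_derivative rate k x (V x)) (at x)"
        unfolding picard_def by (auto intro!: derivative_eq_intros)
      then show "\<exists>y. ((\<lambda>s. picard k V s - V s) has_real_derivative y) (at x) \<and> 0 \<le> y"
        using deriv[of x] x s by (intro exI[of _ "rate k x (V x) - V' x"]) (auto intro: DERIV_diff)
    qed (use s in auto)
    then show ?thesis using V0 by (simp add: picard_def)
  qed
  then show ?thesis using cont le by (simp add: lower_sol_def)
qed

lemma sol_pos:
  assumes Y: "sol k Y" "0 \<le> Y \<theta>" and k: "0 < k" and s: "0 \<le> s" "s < \<theta>"
  shows "Y s > 0"
proof (rule ccontr)
  assume neg: "\<not> Y s > 0"
  have "0 < (k/\<nu>)\<^sup>2" using k \<nu>_pos by simp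
  then have "Y 0 > 0" using sol_0[OF Y(1)] by linarith
  with neg s have s0: "0 < s" by (cases "s = 0") auto
  have cont: "continuous_on {s..\<theta>} Y"
    using Y(1) s unfolding sol_def by (auto elim: continuous_on_subset)
  have nomin: False if r: "s \<le> r" "r < \<theta>" "Y r \<le> 0" "\<And>x. s \<le> x \<Longrightarrow> x \<le> \<theta> \<Longrightarrow> Y r \<le> Y x" for r
  proof -
    have "(Y has_real_derivative rate k r (Y r)) (at r within {0..\<theta>})"
      using sol_deriv[OF Y(1)] r s by auto
    moreover have "rate k r (Y r) < 0" using r s0 D_pos by (simp add: rate_def divide_less_0_iff)
    ultimately obtain d where d: "d > 0" "\<And>h. h > 0 \<Longrightarrow> r + h \<in> {0..\<theta>} \<Longrightarrow> h < d \<Longrightarrow> Y r > Y (r + h)"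
      using has_real_derivative_neg_dec_right by blast
    define h where "h = min (d/2) (\<theta> - r)"
    have "h > 0" "h < d" "r + h \<le> \<theta>" using d r by (auto simp: h_def)
    then show False using d(2)[of h] r(4)[of "r+h"] r(1) s0 by auto
  qed
  obtain r where r: "r \<in> {s..\<theta>}" "\<And>x. x \<in> {s..\<theta>} \<Longrightarrow> Y r \<le> Y x"
    using continuous_attains_inf[OF compact_Icc _ cont] s by auto
  show False
  proof (cases "r < \<theta>")
    case True
    moreover have "Y r \<le> 0" using r(2)[of s] neg s by auto
    ultimately show False using nomin[of r] r by auto
  next
    case False
    then have "r = \<theta>" using r by auto
    then have "Y s = Y r" "Y s \<le> 0" using Y(2) neg r(2)[of s] s by auto
    then show False using nomin[of s] r(2) s by auto
  qed
qed

lemma sol_le: "sol k Y \<Longrightarrow> 0 \<le> s \<Longrightarrow> s \<le> \<theta> \<Longrightarrow> Y s \<le> M"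
  unfolding sol_def by (meson atLeastAtMost_iff)

lemma lower_sol_mono_speed:
  assumes "sol k Y" "0 \<le> k" "k \<le> l"
  shows "lower_sol l Y"
  using assms picard_mono[of Y Y k l] unfolding sol_def lower_sol_def by fastforce

lemma survives_near_kmax: "\<exists>k Y. 0 < k \<and> k < kmax \<and> maximal_sol k Y \<and> 0 \<le> Y \<theta>"
proof -
  let ?\<chi> = "\<lambda>k. 2 * k\<^sup>2 / \<nu> - (\<theta> - k\<^sup>2 / (4*D))\<^sup>2"
  have "(?\<chi> \<longlongrightarrow> ?\<chi> kmax) (at_left kmax)"
    using \<nu>_pos D_pos by (intro tendsto_intros) auto
  moreover have "?\<chi> kmax > 0"
    using \<nu>_pos D_pos \<theta>_pos by (simp add: power_mult_distrib)
  ultimately have "\<forall>\<^sub>F k in at_left kmax. 0 < ?\<chi> k" using order_tendstoD(1) by blast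
  moreover have "\<forall>\<^sub>F k in at_left kmax. k \<in> {0<..<kmax}"
    using eventually_at_left_real[OF kmax_pos] by simp
  ultimately have "\<forall>\<^sub>F k in at_left kmax. 0 < ?\<chi> k \<and> k \<in> {0<..<kmax}" by eventually_elim auto
  then obtain k where \<chi>: "0 < ?\<chi> k" and k: "0 < k" "k < kmax"
    using eventually_happens trivial_limit_at_left_real by (metis (no_types, lifting) greaterThanLessThan_iff)
  define V where "V s = (k/\<nu> + k * s/(2*D))\<^sup>2/2" for s
  have "lower_sol k V"
  proof (rule lower_solI)
    show "V 0 \<le> (k/\<nu>)\<^sup>2/2" by (simp add: V_def)
    show "continuous_on {0..\<theta>} V" unfolding V_def using D_pos by (intro continuous_intros) auto
    show "V s \<le> M" if "s \<in> {0..\<theta>}" for s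
    proof -
      have "k * s / (2*D) \<le> k * \<theta> / (2*D)"
        using that k D_pos by (intro divide_right_mono mult_left_mono) auto
      then have "(k/\<nu> + k * s/(2*D))\<^sup>2 \<le> (k/\<nu> + k*\<theta>/(2*D))\<^sup>2"
        using that k \<nu>_pos D_pos by (intro power_mono) auto
      then show ?thesis using M_linear[of k] k by (simp add: V_def)
    qed
    fix s assume s: "0 < s" "s < \<theta>"
    define P where "P = k/\<nu> + k * s/(2*D)"
    have P: "P > 0" using s k \<nu>_pos D_pos by (simp add: P_def add_pos_pos)
    have sq: "sqrt (2 * max 0 (V s)) = P" using P by (simp add: V_def P_def[symmetric])
    have "(V has_real_derivative P * k / (2*D)) (at s)"
      unfolding V_def P_def using D_pos by (auto intro!: derivative_eq_intros)
    moreover have "P * k / (2*D) \<le> rate k s (V s)"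
    proof -
      let ?\<eta> = "\<theta> - k\<^sup>2/(4*D)"
      have "s * \<eta> - s\<^sup>2 \<le> \<eta>\<^sup>2/4" for \<eta>
        using zero_le_power2[of "\<eta>/2 - s"] by (simp add: power2_eq_square algebra_simps)
      then have "s * ?\<eta> - s\<^sup>2 \<le> ?\<eta>\<^sup>2/4" .
      also have "\<dots> \<le> k\<^sup>2/(2*\<nu>)" using \<chi> by simp
      finally have "s * (\<theta> - s) \<le> k\<^sup>2/(2*\<nu>) + s * (k\<^sup>2/(4*D))" by (simp add: power2_eq_square algebra_simps)
      also have "\<dots> = k * P / 2" using \<nu>_pos D_pos by (simp add: P_def field_simps power2_eq_square)
      finally have "k * P / 2 \<le> k * P - s * (\<theta> - s)" by linarith
      then have "k * P / 2 / D \<le> (k * P - s * (\<theta> - s)) / D" using D_pos by (intro divide_right_mono) auto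
      then show ?thesis unfolding rate_def sq by (simp add: mult_ac)
    qed
    ultimately show "(V has_real_derivative P * k / (2*D)) (at s) \<and> P * k / (2*D) \<le> rate k s (V s)" by blast
  qed
  moreover obtain Y where Y: "maximal_sol k Y" using ex_maximal_sol k by fastforce
  ultimately have "V \<theta> \<le> Y \<theta>" unfolding maximal_sol_def using \<theta>_pos by auto
  moreover have "0 \<le> V \<theta>" by (simp add: V_def)
  ultimately show ?thesis using Y k by fastforce
qed

lemma dies_for_small_speed: "\<exists>\<kappa>>0. \<forall>k Y. 0 < k \<longrightarrow> k < \<kappa> \<longrightarrow> sol k Y \<longrightarrow> Y \<theta> < 0"
proof -
  let ?\<psi> = "\<lambda>k. (k/\<nu>)\<^sup>2/2 + (k * sqrt (2*M) * \<theta> - \<theta>^3/6) / D"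
  have "(?\<psi> \<longlongrightarrow> ?\<psi> 0) (at_right 0)"
    using \<nu>_pos D_pos by (intro tendsto_intros) auto
  moreover have "?\<psi> 0 < 0" using D_pos \<theta>_pos by simp
  ultimately have "\<forall>\<^sub>F k in at_right 0. ?\<psi> k < 0" using order_tendstoD(2) by blast
  then obtain \<kappa> where \<kappa>: "\<kappa> > 0" "\<And>k. 0 < k \<Longrightarrow> k < \<kappa> \<Longrightarrow> ?\<psi> k < 0"
    using eventually_at_right[of "0::real" 1] by auto
  have "Y \<theta> < 0" if k: "0 < k" "k < \<kappa>" and Y: "sol k Y" for k Y
  proof -
    let ?G = "\<lambda>s. (k * sqrt (2*M) * s - (\<theta> * s\<^sup>2/2 - s^3/3)) / D"
    have "?G 0 - Y 0 \<le> ?G \<theta> - Y \<theta>"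
    proof (rule DERIV_nonneg_imp_increasing_open[where f="\<lambda>s. ?G s - Y s"])
      show "continuous_on {0..\<theta>} (\<lambda>s. ?G s - Y s)"
        using Y D_pos unfolding sol_def by (intro continuous_intros) auto
      fix s assume s: "0 < s" "s < \<theta>"
      have "(Y has_real_derivative rate k s (Y s)) (at s)"
        using sol_deriv[OF Y, of s] s at_within_Icc_at[of 0 s \<theta>] by simp
      moreover have "(?G has_real_derivative (k * sqrt (2*M) - s * (\<theta> - s)) / D) (at s)"
        using D_pos by (auto intro!: derivative_eq_intros simp: power2_eq_square field_simps)
      moreover have "rate k s (Y s) \<le> (k * sqrt (2*M) - s * (\<theta> - s)) / D"
        unfolding rate_def using sol_le[OF Y, of s] s k M_pos D_pos
        by (intro divide_right_mono diff_right_mono mult_left_mono real_sqrt_le_mono) auto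
      ultimately show "\<exists>y. ((\<lambda>s. ?G s - Y s) has_real_derivative y) (at s) \<and> 0 \<le> y"
        by (intro exI[of _ "(k * sqrt (2*M) - s * (\<theta> - s)) / D - rate k s (Y s)"]) (auto intro: DERIV_diff)
    qed (use \<theta>_pos in auto)
    moreover have "?G \<theta> = (k * sqrt (2*M) * \<theta> - \<theta>^3/6) / D" by (simp add: power2_eq_square power3_eq_cube)
    ultimately have "Y \<theta> \<le> ?\<psi> k" using sol_0[OF Y] by simp
    then show ?thesis using \<kappa>(2)[OF k] by linarith
  qed
  then show ?thesis using \<kappa>(1) by blast
qed

lemma survival_open:
  assumes Z: "sol k Z" "0 < Z \<theta>" and k: "0 < k" "k \<le> kmax"
  shows "\<exists>l Y. 0 < l \<and> l < k \<and> maximal_sol l Y \<and> 0 \<le> Y \<theta>"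
proof -
  have cont: "continuous_on {0..\<theta>} Z" using Z unfolding sol_def by auto
  obtain r where r: "r \<in> {0..\<theta>}" "\<And>x. x \<in> {0..\<theta>} \<Longrightarrow> Z r \<le> Z x"
    using continuous_attains_inf[OF compact_Icc _ cont] \<theta>_pos by auto
  define e where "e = Z r / 2"
  have "Z r > 0" using sol_pos[OF Z(1) _ k(1), of r] Z(2) r by (cases "r = \<theta>") auto
  then have e: "e > 0" by (simp add: e_def)
  have Zge: "2 * e \<le> Z s" if "s \<in> {0..\<theta>}" for s using r(2)[OF that] by (simp add: e_def)
  define c where "c = sqrt (2*e)"
  have c: "c > 0" using e by (simp add: c_def)
  define L where "L = (2 * k / c + 1) / D"
  have L: "L > 0" using k c D_pos by (simp add: L_def add_pos_pos)
  define \<epsilon> where "\<epsilon> = e * exp (- L * \<theta>)"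
  have \<epsilon>: "\<epsilon> > 0" using e by (simp add: \<epsilon>_def)
  have "((\<lambda>l. (k - l) * sqrt (2*M)) \<longlongrightarrow> (k - k) * sqrt (2*M)) (at_left k)"
    by (intro tendsto_intros)
  then have "\<forall>\<^sub>F l in at_left k. (k - l) * sqrt (2*M) < \<epsilon>" using order_tendstoD(2)[OF _ , of _ 0 "at_left k" \<epsilon>] \<epsilon> by simp
  moreover have "((\<lambda>l. (k/\<nu>)\<^sup>2/2 - (l/\<nu>)\<^sup>2/2) \<longlongrightarrow> (k/\<nu>)\<^sup>2/2 - (k/\<nu>)\<^sup>2/2) (at_left k)"
    using \<nu>_pos by (intro tendsto_intros) auto
  then have "\<forall>\<^sub>F l in at_left k. (k/\<nu>)\<^sup>2/2 - (l/\<nu>)\<^sup>2/2 < \<epsilon>" using order_tendstoD(2)[OF _ , of _ 0 "at_left k" \<epsilon>] \<epsilon> by simp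
  moreover have "\<forall>\<^sub>F l in at_left k. l \<in> {0<..<k}"
    using eventually_at_left_real[OF k(1)] by simp
  ultimately have "\<forall>\<^sub>F l in at_left k. (k - l) * sqrt (2*M) < \<epsilon> \<and> (k/\<nu>)\<^sup>2/2 - (l/\<nu>)\<^sup>2/2 < \<epsilon> \<and> l \<in> {0<..<k}"
    by eventually_elim auto
  then obtain l where l: "(k - l) * sqrt (2*M) < \<epsilon>" "(k/\<nu>)\<^sup>2/2 - (l/\<nu>)\<^sup>2/2 < \<epsilon>" "0 < l" "l < k"
    using eventually_happens trivial_limit_at_left_real by (metis (no_types, lifting) greaterThanLessThan_iff)
  define V where "V s = Z s - \<epsilon> * exp (L * s)" for s
  have Vge: "e \<le> V s" if s: "s \<in> {0..\<theta>}" for s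
  proof -
    have "\<epsilon> * exp (L * s) \<le> \<epsilon> * exp (L * \<theta>)" using s \<epsilon> L by auto
    also have "\<dots> = e" by (simp add: \<epsilon>_def exp_minus field_simps)
    finally show ?thesis using Zge[OF s] by (simp add: V_def)
  qed
  have "lower_sol l V"
  proof (rule lower_solI)
    show "V 0 \<le> (l/\<nu>)\<^sup>2/2" using l(2) sol_0[OF Z(1)] by (simp add: V_def)
    show "continuous_on {0..\<theta>} V" unfolding V_def using cont by (intro continuous_intros)
    show "V s \<le> M" if "s \<in> {0..\<theta>}" for s
      using Z(1) that \<epsilon> unfolding V_def sol_def by (smt (verit) exp_gt_zero mult_pos_pos)
    fix s assume s: "0 < s" "s < \<theta>"
    have dZ: "(Z has_real_derivative rate k s (Z s)) (at s)"
      using sol_deriv[OF Z(1), of s] s at_within_Icc_at[of 0 s \<theta>] by simp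
    have "(V has_real_derivative rate k s (Z s) - \<epsilon> * (L * exp (L * s))) (at s)"
      unfolding V_def by (auto intro!: derivative_eq_intros dZ)
    moreover have "rate k s (Z s) - \<epsilon> * (L * exp (L * s)) \<le> rate l s (V s)"
    proof -
      define E where "E = \<epsilon> * exp (L * s)"
      have E: "\<epsilon> \<le> E" using \<epsilon> L s by (simp add: E_def)
      have VZ: "e \<le> V s" "V s = Z s - E" "2 * e \<le> Z s" "Z s \<le> M"
        using Vge[of s] Zge[of s] s sol_le[OF Z(1), of s] unfolding V_def E_def by auto
      let ?a = "sqrt (2 * Z s)" and ?b = "sqrt (2 * V s)"
      have b: "c \<le> ?b" "?b \<le> ?a" using VZ E \<epsilon> by (auto simp: c_def)
      have "c * (?a - ?b) \<le> (?a + ?b) * (?a - ?b)" using b c by (intro mult_right_mono) linarith+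
      also have "\<dots> = ?a\<^sup>2 - ?b\<^sup>2" by (simp add: power2_eq_square algebra_simps)
      also have "\<dots> = 2 * E" using VZ e by simp
      finally have "?a - ?b \<le> 2 * E / c" using c by (simp add: field_simps)
      then have "k * (?a - ?b) \<le> k * (2 * E / c)" using k by (intro mult_left_mono) auto
      moreover have "(k - l) * ?b \<le> (k - l) * sqrt (2*M)"
        using l VZ E \<epsilon> by (intro mult_left_mono) auto
      ultimately have "k * ?a - l * ?b \<le> k * (2 * E / c) + E" using l(1) E by (simp add: algebra_simps)
      also have "\<dots> = (2 * k / c + 1) * E" by (simp add: algebra_simps)
      also have "\<dots> = D * (L * E)" using D_pos by (simp add: L_def)
      finally have "k * ?a - s * (\<theta> - s) - D * (L * E) \<le> l * ?b - s * (\<theta> - s)" by simp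
      then have "(k * ?a - s * (\<theta> - s) - D * (L * E)) / D \<le> (l * ?b - s * (\<theta> - s)) / D" 
        using D_pos by (intro divide_right_mono) auto
      moreover have "(k * ?a - s * (\<theta> - s) - D * (L * E)) / D = (k * ?a - s * (\<theta> - s)) / D - L * E"
        using D_pos by (simp add: field_simps)
      ultimately show ?thesis
        using VZ e by (simp add: rate_def E_def max_def mult_ac)
    qed
    ultimately show "(V has_real_derivative rate k s (Z s) - \<epsilon> * (L * exp (L * s))) (at s) \<and>
      rate k s (Z s) - \<epsilon> * (L * exp (L * s)) \<le> rate l s (V s)" by blast
  qed
  moreover obtain Y where Y: "maximal_sol l Y" using ex_maximal_sol l k by fastforce
  ultimately have "V \<theta> \<le> Y \<theta>" unfolding maximal_sol_def using \<theta>_pos by auto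
  then have "0 \<le> Y \<theta>" using Vge[of \<theta>] \<theta>_pos e by auto
  then show ?thesis using Y l by blast
qed

lemma ex_critical_speed: "\<exists>k Y. 0 < k \<and> k < kmax \<and> sol k Y \<and> Y \<theta> = 0"
proof -
  define S where "S = {k. 0 < k \<and> (\<exists>Y. maximal_sol k Y \<and> 0 \<le> Y \<theta>)}"
  define k where "k = Inf S"
  obtain \<kappa> where \<kappa>: "\<kappa> > 0" "\<And>k Y. 0 < k \<Longrightarrow> k < \<kappa> \<Longrightarrow> sol k Y \<Longrightarrow> Y \<theta> < 0"
    using dies_for_small_speed by blast
  have S_ge: "\<kappa> \<le> l" if "l \<in> S" for l
    using \<kappa>(2)[of l] that unfolding S_def maximal_sol_def by fastforce
  then have bdd: "bdd_below S" by (auto simp: bdd_below_def)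
  obtain k1 where k1: "k1 \<in> S" "k1 < kmax" using survives_near_kmax unfolding S_def by blast
  have k_pos: "0 < k" using cInf_greatest[of S \<kappa>] S_ge k1 \<kappa>(1) by (force simp: k_def)
  have k_lt: "k < kmax" using cInf_lower[OF k1(1) bdd] k1(2) by (simp add: k_def)
  have up: "\<exists>Y. maximal_sol l Y \<and> 0 \<le> Y \<theta>" if l: "k < l" "l \<le> kmax" for l
  proof -
    obtain j where "j \<in> S" "j < l" using cInf_lessD[of S l] l k1 by (auto simp: k_def)
    then obtain X where X: "0 < j" "j < l" "maximal_sol j X" "0 \<le> X \<theta>" by (auto simp: S_def)
    obtain Y where Y: "maximal_sol l Y" using ex_maximal_sol[of l] l k_pos by auto
    have "lower_sol l X" using lower_sol_mono_speed[of j X l] X by (auto simp: maximal_sol_def)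
    then have "X \<theta> \<le> Y \<theta>" using Y \<theta>_pos by (auto simp: maximal_sol_def)
    then show ?thesis using Y X by force
  qed
  define l where "l n = k + (kmax - k) / real (Suc n)" for n
  have l: "k < l n" "l n \<le> kmax" for n
  proof -
    show "k < l n" using k_lt by (simp add: l_def)
    have "(kmax - k) / real (Suc n) \<le> (kmax - k) / 1" using k_lt by (intro divide_left_mono) auto
    then show "l n \<le> kmax" by (simp add: l_def)
  qed
  have l_dec: "l (Suc n) \<le> l n" for n
    unfolding l_def using k_lt by (intro add_left_mono divide_left_mono) auto
  have l_lim: "l \<longlonglongrightarrow> k"
  proof -
    have "(\<lambda>n. k + (kmax - k) * (1 / real (Suc n))) \<longlonglongrightarrow> k + (kmax - k) * 0"
      using LIMSEQ_Suc[OF lim_1_over_n] by (intro tendsto_intros)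
    then show ?thesis by (simp add: l_def[abs_def])
  qed
  obtain Y where Y: "\<And>n. maximal_sol (l n) (Y n)" "\<And>n. 0 \<le> Y n \<theta>" using up[OF l] by metis
  have Ysol: "continuous_on {0..\<theta>} (Y n)" "\<And>s. s \<in> {0..\<theta>} \<Longrightarrow> Y n s \<le> M"
    "\<And>s. s \<in> {0..\<theta>} \<Longrightarrow> Y n s = picard (l n) (Y n) s" for n
    using Y(1)[of n] unfolding maximal_sol_def sol_def by blast+
  have conv: "convergent (\<lambda>n. Y n s)" if s: "s \<in> {0..\<theta>}" for s
  proof -
    have "Y (Suc n) s \<le> Y n s" for n
      using lower_sol_mono_speed[of "l (Suc n)" "Y (Suc n)" "l n"] Y(1) l_dec[of n] l(1)[of "Suc n"] k_pos s
      unfolding maximal_sol_def by (meson less_imp_le order.trans)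
    then have "decseq (\<lambda>n. Y n s)" by (auto simp: decseq_Suc_iff)
    moreover have "- \<theta> * ((kmax * sqrt (2*M) + \<theta> * \<theta>) / D) \<le> Y n s" for n
    proof -
      have "(l n * sqrt (2*M) + \<theta> * \<theta>) / D \<le> (kmax * sqrt (2*M) + \<theta> * \<theta>) / D"
        using l(2)[of n] M_pos D_pos by (intro divide_right_mono add_right_mono mult_right_mono) auto
      then have "\<theta> * ((l n * sqrt (2*M) + \<theta> * \<theta>) / D) \<le> \<theta> * ((kmax * sqrt (2*M) + \<theta> * \<theta>) / D)"
        using \<theta>_pos by (intro mult_left_mono) auto
      moreover have "- \<theta> * ((l n * sqrt (2*M) + \<theta> * \<theta>) / D) \<le> Y n s"
        unfolding Ysol(3)[OF s] by (rule picard_ge) (use Ysol(1,2) s l(1)[of n] k_pos in auto)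
      ultimately show ?thesis by simp
    qed
    ultimately show ?thesis using decseq_convergent convergentI by metis
  qed
  define Z where "Z s = lim (\<lambda>n. Y n s)" for s
  have Z: "(\<lambda>n. Y n s) \<longlonglongrightarrow> Z s" if "s \<in> {0..\<theta>}" for s
    using conv[OF that] by (simp add: Z_def convergent_LIMSEQ_iff)
  have "\<bar>l n\<bar> \<le> kmax" for n using l[of n] k_pos by auto
  then have lim: "continuous_on {0..\<theta>} (picard k Z)"
    "\<And>s. s \<in> {0..\<theta>} \<Longrightarrow> (\<lambda>n. picard (l n) (Y n) s) \<longlonglongrightarrow> picard k Z s"
    using picard_limit[of Y Z l k kmax] Ysol(1,2) Z l_lim by auto
  have eq: "Z s = picard k Z s" if "s \<in> {0..\<theta>}" for s
    using lim(2)[OF that] Z[OF that] LIMSEQ_unique Ysol(3)[OF that] by simp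
  have "continuous_on {0..\<theta>} Z"
    by (rule continuous_on_eq[OF lim(1)]) (simp add: eq[symmetric])
  moreover have "Z s \<le> M" if "s \<in> {0..\<theta>}" for s
    using LIMSEQ_le_const2[OF Z[OF that]] Ysol(2)[OF that] by blast
  ultimately have sol: "sol k Z" using eq by (auto simp: sol_def)
  have "0 \<le> Z \<theta>" using LIMSEQ_le_const[OF Z[of \<theta>]] Y(2) \<theta>_pos by auto
  moreover have "\<not> 0 < Z \<theta>"
  proof
    assume "0 < Z \<theta>"
    then obtain j X where "0 < j" "j < k" "maximal_sol j X" "0 \<le> X \<theta>"
      using survival_open[OF sol _ k_pos] k_lt by auto
    then show False using cInf_lower[OF _ bdd, of j] by (force simp: S_def k_def)
  qed
  ultimately show ?thesis using sol k_pos k_lt by force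
qed

lemma sol_semi_wave:
  assumes Y: "sol k Y" "Y \<theta> = 0" and k: "0 < k"
  shows "\<exists>q. semi_wave \<nu> D \<theta> k q"
proof -
  have contY: "continuous_on {0..\<theta>} Y" using Y unfolding sol_def by auto
  have Ypos: "Y s > 0" if "0 \<le> s" "s < \<theta>" for s
    using sol_pos[OF Y(1) _ k] Y(2) that by auto
  have dY: "(Y has_real_derivative rate k s (Y s)) (at s)" if "0 < s" "s < \<theta>" for s
    using sol_deriv[OF Y(1), of s] that at_within_Icc_at[of 0 s \<theta>] by simp
  define p where "p s = sqrt (2 * Y (max 0 s))" for s
  have ppos: "p s > 0" if "s < \<theta>" for s
    using Ypos[of "max 0 s"] that \<theta>_pos by (simp add: p_def)
  have psq: "p s ^ 2 = 2 * Y s" if "0 \<le> s" "s < \<theta>" for s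
    using Ypos[of s] that by (simp add: p_def)
  have pcont: "continuous_on {..\<theta>} p"
    unfolding p_def
    by (intro continuous_intros continuous_on_compose2[OF contY]) (use \<theta>_pos in auto)
  have "2 * Y 0 = (k/\<nu>)\<^sup>2" using sol_0[OF Y(1)] by simp
  then have p0: "p 0 = k / \<nu>" using k \<nu>_pos unfolding p_def by simp
  have dp: "(p has_real_derivative rate k s (Y s) / p s) (at s)" if s: "0 < s" "s < \<theta>" for s
  proof -
    have "((\<lambda>s. sqrt (2 * Y s)) has_real_derivative rate k s (Y s) / sqrt (2 * Y s)) (at s)"
      using dY[OF s] Ypos[of s] s by (auto intro!: derivative_eq_intros simp: field_simps)
    then have "((\<lambda>s. sqrt (2 * Y s)) has_real_derivative rate k s (Y s) / p s) (at s)"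
      using s by (simp add: p_def)
    moreover have "\<forall>\<^sub>F r in nhds s. sqrt (2 * Y r) = p r"
      using eventually_nhds_in_open[of "{0<..}" s] s by (auto elim!: eventually_mono simp: p_def)
    ultimately show ?thesis by (subst DERIV_cong_ev[OF refl _ refl]) (auto elim: eventually_mono)
  qed
  have p_le: "p s \<le> sqrt (\<theta>/D) * (\<theta> - s)" if s: "0 \<le> s" "s < \<theta>" for s
  proof -
    let ?G = "\<lambda>s. \<theta> * (\<theta> - s)\<^sup>2 / (2*D)"
    have "Y s - ?G s \<le> Y \<theta> - ?G \<theta>"
    proof (rule DERIV_nonneg_imp_increasing_open[where f="\<lambda>s. Y s - ?G s"])
      show "continuous_on {s..\<theta>} (\<lambda>s. Y s - ?G s)"
        using D_pos s continuous_on_subset[OF contY, of "{s..\<theta>}"] by (intro continuous_intros) auto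
      fix x assume x: "s < x" "x < \<theta>"
      have "((\<lambda>s. Y s - ?G s) has_real_derivative rate k x (Y x) + \<theta> * (\<theta> - x) / D) (at x)"
        using D_pos x s by (auto intro!: derivative_eq_intros dY simp: field_simps)
      moreover have "0 \<le> rate k x (Y x) + \<theta> * (\<theta> - x) / D"
      proof -
        have "x * (\<theta> - x) \<le> \<theta> * (\<theta> - x)" using x by (intro mult_right_mono) auto
        moreover have "0 \<le> k * sqrt (2 * max 0 (Y x))" using k by simp
        ultimately have "0 \<le> (k * sqrt (2 * max 0 (Y x)) - x * (\<theta> - x) + \<theta> * (\<theta> - x)) / D"
          using D_pos by (intro divide_nonneg_pos) linarith+
        then show ?thesis by (simp add: rate_def add_divide_distrib)
      qed
      ultimately show "\<exists>y. ((\<lambda>s. Y s - ?G s) has_real_derivative y) (at x) \<and> 0 \<le> y" by blast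
    qed (use s in auto)
    then have "2 * Y s \<le> \<theta> / D * (\<theta> - s)\<^sup>2" using Y(2) by simp
    then have "sqrt (2 * Y s) \<le> sqrt (\<theta> / D * (\<theta> - s)\<^sup>2)" by (rule real_sqrt_le_mono)
    also have "\<dots> = sqrt (\<theta> / D) * (\<theta> - s)" using s by (subst real_sqrt_mult) simp
    finally show ?thesis using s by (simp add: p_def)
  qed
  define X where "X s = integral {-1..s} (\<lambda>r. 1 / p r)" for s
  have inv_cont: "continuous_on {-1..b} (\<lambda>r. 1 / p r)" if "b < \<theta>" for b
  proof -
    have "p r \<noteq> 0" if "r \<in> {-1..b}" for r using ppos[of r] that \<open>b < \<theta>\<close> by auto
    then show ?thesis using continuous_on_subset[OF pcont, of "{-1..b}"] that
      by (intro continuous_intros) auto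
  qed
  have dX: "(X has_real_derivative 1 / p s) (at s)" if s: "-1 < s" "s < \<theta>" for s
  proof -
    obtain b where b: "s < b" "b < \<theta>" using s dense by blast
    have "(X has_real_derivative 1 / p s) (at s within {-1..b})"
      unfolding X_def[abs_def] using inv_cont[OF b(2)] s b by (intro integral_has_real_derivative) auto
    then show ?thesis using at_within_Icc_at[of "-1" s b] s b by simp
  qed
  have Xcont: "continuous_on {-1<..<\<theta>} X"
    using dX by (intro continuous_at_imp_continuous_on ballI DERIV_isCont) auto
  have Xmono: "X s < X t" if "-1 < s" "s < t" "t < \<theta>" for s t
  proof (rule DERIV_pos_imp_increasing_open[OF that(2)])
    show "continuous_on {s..t} X" using Xcont by (rule continuous_on_subset) (use that in auto)
    show "\<exists>y. (X has_real_derivative y) (at x) \<and> 0 < y" if "s < x" "x < t" for x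
      using dX[of x] ppos[of x] that \<open>-1 < s\<close> \<open>t < \<theta>\<close> by (intro exI[of _ "1 / p x"]) auto
  qed
  have Xle: "s \<le> t" if "-1 < t" "s < \<theta>" "X s \<le> X t" for s t
    using Xmono[of t s] that by force
  define C where "C = sqrt (\<theta>/D)"
  have C: "C > 0" using \<theta>_pos D_pos by (simp add: C_def)
  have Xgrow: "X 0 + (ln \<theta> - ln (\<theta> - s)) / C \<le> X s" if s: "0 \<le> s" "s < \<theta>" for s
  proof -
    have "X 0 + ln (\<theta> - 0) / C \<le> X s + ln (\<theta> - s) / C"
    proof (rule DERIV_nonneg_imp_increasing_open[where f="\<lambda>s. X s + ln (\<theta> - s) / C"])
      show "continuous_on {0..s} (\<lambda>s. X s + ln (\<theta> - s) / C)"
        using s C by (intro continuous_intros continuous_on_subset[OF Xcont]) auto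
      fix x assume x: "0 < x" "x < s"
      have "((\<lambda>s. X s + ln (\<theta> - s) / C) has_real_derivative 1 / p x - 1 / (C * (\<theta> - x))) (at x)"
        using x s C by (auto intro!: derivative_eq_intros dX)
      moreover have "1 / (C * (\<theta> - x)) \<le> 1 / p x"
        using p_le[of x] ppos[of x] x s C by (intro divide_left_mono) (auto simp: C_def)
      ultimately show "\<exists>y. ((\<lambda>s. X s + ln (\<theta> - s) / C) has_real_derivative y) (at x) \<and> 0 \<le> y"
        by (intro exI[of _ "1 / p x - 1 / (C * (\<theta> - x))"]) auto
    qed (use s in auto)
    then show ?thesis by (simp add: diff_divide_distrib)
  qed
  define a :: real where "a = - 1 / 2"
  define lo where "lo = X a - X 0"
  have lo: "lo < 0" using Xmono[of a 0] \<theta>_pos by (simp add: lo_def a_def)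
  have surj: "\<exists>s. a < s \<and> s < \<theta> \<and> X s = X 0 + x" if x: "lo < x" for x
  proof -
    define b where "b = \<theta> - \<theta> * exp (- C * \<bar>x\<bar>)"
    have b: "0 \<le> b" "b < \<theta>" using \<theta>_pos C by (auto simp: b_def)
    have "ln (\<theta> - b) = ln \<theta> + (- C * \<bar>x\<bar>)" using \<theta>_pos by (simp add: b_def ln_mult)
    then have "X 0 + x \<le> X b" using Xgrow[OF b] C by simp
    moreover have "X a \<le> X 0 + x" using x by (simp add: lo_def)
    moreover have "continuous_on {a..b} X" using Xcont by (rule continuous_on_subset) (use b in \<open>auto simp: a_def\<close>)
    moreover have "a \<le> b" using b by (simp add: a_def)
    ultimately obtain s where s: "a \<le> s" "s \<le> b" "X s = X 0 + x" using IVT'[of X a "X 0 + x" b] by auto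
    moreover have "s \<noteq> a" using s(3) x by (auto simp: lo_def)
    ultimately show ?thesis using b by (intro exI[of _ s]) auto
  qed
  define q where "q x = (SOME s. a < s \<and> s < \<theta> \<and> X s = X 0 + x)" for x
  have q: "a < q x" "q x < \<theta>" "X (q x) = X 0 + x" if "lo < x" for x
    using someI_ex[OF surj[OF that]] by (auto simp: q_def)
  have qX: "q (X s - X 0) = s" if s: "a < s" "s < \<theta>" for s
  proof -
    have "lo < X s - X 0" using Xmono[of a s] s by (simp add: lo_def a_def)
    then show ?thesis using q[of "X s - X 0"] Xle[of s "q (X s - X 0)"] Xle[of "q (X s - X 0)" s] s
      by (force simp: a_def)
  qed
  have qmono: "q x \<le> q y" if "lo < x" "x \<le> y" for x y
    using Xle[of "q y" "q x"] q[of x] q[of y] that by (auto simp: a_def)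
  have q0: "q 0 = 0" using qX[of 0] \<theta>_pos by (simp add: a_def)
  have qcont: "isCont q x" if x: "lo < x" for x
  proof -
    obtain e where e: "q x < e" "e < \<theta>" using q(2)[OF x] dense by blast
    obtain f where f: "a < f" "f < q x" using q(1)[OF x] dense by blast
    have "isCont q (X (q x) - X 0)"
    proof (rule isCont_inverse_function2[where f="\<lambda>s. X s - X 0" and a=f and b=e])
      show "q (X z - X 0) = z" if "f \<le> z" "z \<le> e" for z using qX that e f by auto
      show "isCont (\<lambda>s. X s - X 0) z" if "f \<le> z" "z \<le> e" for z
        using DERIV_isCont[OF dX[of z]] that e f by (auto simp: a_def intro!: continuous_intros)
    qed (use e f in auto)
    then show ?thesis using q(3)[OF x] by simp
  qed
  have dq: "(q has_real_derivative p (q x)) (at x)" if x: "lo < x" for x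
  proof -
    have "(q has_real_derivative inverse (1 / p (q x))) (at x)"
    proof (rule DERIV_inverse_function[where f="\<lambda>s. X s - X 0" and a=lo and b="x+1"])
      show "((\<lambda>s. X s - X 0) has_real_derivative 1 / p (q x)) (at (q x))"
        using dX[of "q x"] q[OF x] by (auto simp: a_def intro!: derivative_eq_intros)
      show "1 / p (q x) \<noteq> 0" using ppos[of "q x"] q[OF x] by auto
    qed (use x q qcont in auto)
    then show ?thesis by simp
  qed
  have q_pos: "0 < q x" if "0 < x" for x
  proof -
    have "0 \<le> q x" using qmono[of 0 x] q0 lo that by simp
    moreover have "q x \<noteq> 0" using q(3)[of x] that lo by auto
    ultimately show ?thesis by simp
  qed
  have "semi_wave \<nu> D \<theta> k q"
    unfolding semi_wave_def
  proof (intro exI conjI allI impI)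
    show "(q has_real_derivative p (q x)) (at x within {0..})" if "0 \<le> x" for x
      using dq[of x] lo that has_field_derivative_at_within by fastforce
    show "continuous_on {0..} (\<lambda>x. p (q x))"
    proof (rule continuous_on_compose2[OF pcont])
      show "continuous_on {0..} q" using qcont lo by (intro continuous_at_imp_continuous_on) auto
      show "q ` {0..} \<subseteq> {..\<theta>}" using q(2) lo by (auto intro: less_imp_le)
    qed
    fix x :: real assume x: "0 < x"
    have qx: "0 < q x" "q x < \<theta>" using q_pos[OF x] q(2)[of x] x lo by auto
    show "((\<lambda>x. p (q x)) has_real_derivative rate k (q x) (Y (q x))) (at x)"
    proof -
      have "((\<lambda>x. p (q x)) has_real_derivative rate k (q x) (Y (q x)) / p (q x) * p (q x)) (at x)"
        using x lo by (intro DERIV_chain2[where f=p and g=q, OF dp[OF qx] dq]) auto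
      then show ?thesis using ppos[of "q x"] qx by simp
    qed
    show "D * rate k (q x) (Y (q x)) - k * p (q x) + q x * (\<theta> - q x) = 0"
      using D_pos Ypos[of "q x"] qx by (simp add: rate_def p_def max_def)
    show "0 < p (q x)" using ppos qx by blast
  next
    show "q 0 = 0" "p (q 0) = k / \<nu>" using q0 p0 by auto
    show "(q \<longlongrightarrow> \<theta>) at_top"
    proof (rule order_tendstoI)
      fix s assume s: "s < \<theta>"
      obtain t where t: "max a s < t" "t < \<theta>" using s dense[of "max a s" \<theta>] \<theta>_pos by (auto simp: a_def)
      show "\<forall>\<^sub>F x in at_top. s < q x"
        using eventually_ge_at_top[of "X t - X 0"]
      proof eventually_elim
        case (elim x)
        have "lo < X t - X 0" using Xmono[of a t] t by (simp add: lo_def a_def)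
        then have "q (X t - X 0) \<le> q x" using qmono elim by blast
        then show ?case using qX[of t] t by simp
      qed
    next
      fix s assume s: "\<theta> < s"
      show "\<forall>\<^sub>F x in at_top. q x < s"
        using eventually_ge_at_top[of 0]
      proof eventually_elim
        case (elim x)
        then show ?case using q(2)[of x] lo s by simp
      qed
    qed
  qed
  then show ?thesis by blast
qed

end

lemma ex_semi_wave:
  assumes "\<nu> > 0" "D > 0" "\<theta> > 0"
  shows "\<exists>k q. 0 < k \<and> k < 2 * sqrt (\<theta> * D) \<and> semi_wave \<nu> D \<theta> k q"
proof -
  define K where "K = 2 * sqrt (\<theta> * D)"
  have K: "K > 0" using assms by (simp add: K_def)
  define A where "A = (K/\<nu>)\<^sup>2/2"
  define B where "B = K * \<theta> / D"
  have AB: "A \<ge> 0" "B \<ge> 0" using assms K by (auto simp: A_def B_def)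
  define m where "m = max (2*A + 2*B + 2) (K/\<nu> + K * \<theta> / (2*D))"
  have m: "m \<ge> 2*A + 2*B + 2" "m \<ge> K/\<nu> + K * \<theta> / (2*D)" by (auto simp: m_def)
  have "A + B * m \<le> m\<^sup>2/2"
  proof -
    have "A + B * m \<le> A * m + B * m" using AB m(1) mult_left_mono[of 1 m A] by auto
    also have "\<dots> = (2*A + 2*B) * m / 2" by (simp add: algebra_simps)
    also have "\<dots> \<le> m * m / 2" using m(1) AB by (intro divide_right_mono mult_right_mono) auto
    finally show ?thesis by (simp add: power2_eq_square)
  qed
  have "shooting \<nu> D \<theta> (m\<^sup>2/2)"
  proof
    fix k assume k: "0 \<le> k" "k \<le> 2 * sqrt (\<theta> * D)"
    then have kK: "k \<le> K" by (simp add: K_def)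
    have sq: "sqrt (2 * (m\<^sup>2/2)) = m" using m(1) AB by simp
    have "(k/\<nu>)\<^sup>2/2 \<le> A" unfolding A_def using k kK assms by (intro divide_right_mono power_mono) auto
    moreover have "k * \<theta> * m / D \<le> B * m"
    proof -
      have "m \<ge> 0" using m(1) AB by linarith
      then have "0 \<le> \<theta> * m / D" using assms by simp
      then show ?thesis using mult_right_mono[OF kK, of "\<theta> * m / D"] by (simp add: B_def mult_ac)
    qed
    ultimately show "(k/\<nu>)\<^sup>2/2 + k * \<theta> * sqrt (2 * (m\<^sup>2/2)) / D \<le> m\<^sup>2/2"
      unfolding sq using \<open>A + B * m \<le> m\<^sup>2/2\<close> by linarith
    have "k/\<nu> + k * \<theta> / (2*D) \<le> K/\<nu> + K * \<theta> / (2*D)"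
      using kK assms by (intro add_mono divide_right_mono mult_right_mono) auto
    then have "(k/\<nu> + k * \<theta> / (2*D))\<^sup>2 \<le> m\<^sup>2" using m(2) k assms by (intro power_mono) auto
    then show "(k/\<nu> + k * \<theta> / (2*D))\<^sup>2/2 \<le> m\<^sup>2/2" by simp
  qed (use assms m(1) AB in auto)
  then interpret shooting \<nu> D \<theta> "m\<^sup>2/2" .
  show ?thesis using ex_critical_speed sol_semi_wave by blast
qed

lemma kspeed_semi_wave:
  assumes "\<nu> > 0" "D > 0" "\<theta> > 0"
  shows "0 < kspeed \<nu> D \<theta> \<and> (\<exists>q. semi_wave \<nu> D \<theta> (kspeed \<nu> D \<theta>) q)"
proof -
  obtain k q where k: "0 < k" "k < 2 * sqrt (\<theta> * D)" "semi_wave \<nu> D \<theta> k q"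
    using ex_semi_wave[OF assms] by blast
  have "kspeed \<nu> D \<theta> = k" unfolding kspeed_def
  proof (rule the_equality)
    fix l assume "0 < l \<and> l < 2 * sqrt (\<theta> * D) \<and> (\<exists>q. semi_wave \<nu> D \<theta> l q)"
    then show "l = k"
      using semi_wave_speed_not_less[of \<nu> D \<theta>] k(3) assms by (metis linorder_neqE_linordered_idom)
  qed (use k in blast)
  then show ?thesis using k by blast
qed

section \<open>Comparison principles\<close>

definition jet :: "(real \<Rightarrow> real \<Rightarrow> real) \<Rightarrow> real \<Rightarrow> real \<Rightarrow> real \<Rightarrow> real \<Rightarrow> bool" where
  "jet z t x zt zxx \<longleftrightarrow>
     ((\<lambda>\<tau>. z \<tau> x) has_real_derivative zt) (at t) \<and>
     (\<exists>p. (\<forall>\<^sub>F y in nhds x. (z t has_real_derivative p y) (at y)) \<and> (p has_real_derivative zxx) (at x))"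

lemma jet_diff:
  assumes "jet z t x zt zxx" "jet w t x wt wxx"
  shows "jet (\<lambda>t x. z t x - w t x) t x (zt - wt) (zxx - wxx)"
proof -
  obtain p q where 1: "\<forall>\<^sub>F y in nhds x. (z t has_real_derivative p y) (at y)" and p: "(p has_real_derivative zxx) (at x)"
    and 2: "\<forall>\<^sub>F y in nhds x. (w t has_real_derivative q y) (at y)" and q: "(q has_real_derivative wxx) (at x)"
    using assms unfolding jet_def by blast
  from 1 2 have "\<forall>\<^sub>F y in nhds x. ((\<lambda>y. z t y - w t y) has_real_derivative p y - q y) (at y)"
    by eventually_elim (rule DERIV_diff)
  then show ?thesis using assms DERIV_diff[OF p q] unfolding jet_def by (auto intro!: DERIV_diff)
qed

lemma second_derivative_nonneg_at_min:
  fixes f p :: "real \<Rightarrow> real"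
  assumes f: "\<forall>\<^sub>F y in nhds x. (f has_real_derivative p y) (at y)" and p: "(p has_real_derivative D2) (at x)"
    and min: "\<forall>\<^sub>F y in nhds x. f x \<le> f y"
  shows "0 \<le> D2"
proof (rule ccontr)
  assume "\<not> 0 \<le> D2"
  obtain d where d: "d > 0" "\<And>y. \<bar>y - x\<bar> < d \<Longrightarrow> (f has_real_derivative p y) (at y) \<and> f x \<le> f y"
    using eventually_conj[OF f min] unfolding eventually_nhds_metric dist_real_def by blast
  have "p x = 0"
    using DERIV_local_min[of f "p x" x d] d(2)[of x] d by (auto simp: abs_minus_commute)
  moreover obtain e where e: "e > 0" "\<And>h. h > 0 \<Longrightarrow> h < e \<Longrightarrow> p (x + h) < p x"
    using DERIV_neg_dec_right[OF p] \<open>\<not> 0 \<le> D2\<close> by auto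
  define h where "h = min d e / 2"
  have h: "h > 0" "h < d" "h < e" using d e by (auto simp: h_def)
  have "f x > f (x + h)"
  proof (rule DERIV_neg_imp_decreasing_open[of x "x + h" f])
    show "x < x + h" using h by simp
    show "continuous_on {x..x+h} f"
      using d(2) h by (intro continuous_at_imp_continuous_on ballI) (force intro: DERIV_isCont)
    show "\<exists>y. (f has_real_derivative y) (at z) \<and> y < 0" if "x < z" "z < x + h" for z
      using d(2)[of z] e(2)[of "z - x"] that h \<open>p x = 0\<close> by auto
  qed
  then show False using d(2)[of "x+h"] h by auto
qed

text \<open>
  The minimum of \<open>exp (-K t) z - \<epsilon> x\<close> is examined; the term \<open>- \<epsilon> x\<close> keeps it away from a Neumann
  boundary, where no equation is available.
\<close>

lemma minimum_principle:
  fixes z :: "real \<Rightarrow> real \<Rightarrow> real" and r :: "real \<Rightarrow> real"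
  assumes D: "D > 0"
    and cont: "continuous_on {p. T0 \<le> fst p \<and> fst p \<le> T1 \<and> 0 \<le> snd p \<and> snd p \<le> r (fst p)} (\<lambda>p. z (fst p) (snd p))"
    and contr: "continuous_on {T0..T1} r"
    and init: "\<And>x. 0 \<le> x \<Longrightarrow> x \<le> r T0 \<Longrightarrow> 0 \<le> z T0 x"
    and right: "\<And>t. T0 < t \<Longrightarrow> t \<le> T1 \<Longrightarrow> 0 \<le> r t \<Longrightarrow> 0 \<le> z t (r t)"
    and left: "\<And>t. T0 < t \<Longrightarrow> t \<le> T1 \<Longrightarrow> 0 < r t \<Longrightarrow>
       0 \<le> z t 0 \<or> (\<exists>p\<le>0. (z t has_real_derivative p) (at 0 within {0..r t}))"
    and int: "\<And>t x. T0 < t \<Longrightarrow> t \<le> T1 \<Longrightarrow> 0 < x \<Longrightarrow> x < r t \<Longrightarrow> z t x < 0 \<Longrightarrow>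
       \<exists>zt zxx. jet z t x zt zxx \<and> C * z t x \<le> zt - D * zxx"
    and pt: "T0 \<le> t0" "t0 \<le> T1" "0 \<le> x0" "x0 \<le> r t0"
  shows "0 \<le> z t0 x0"
proof (rule ccontr)
  assume neg: "\<not> 0 \<le> z t0 x0"
  define Q where "Q = {p. T0 \<le> fst p \<and> fst p \<le> T1 \<and> 0 \<le> snd p \<and> snd p \<le> r (fst p)}"
  have T: "T0 \<le> T1" using pt by simp
  obtain tm where "tm \<in> {T0..T1}" "\<And>t. t \<in> {T0..T1} \<Longrightarrow> r t \<le> r tm"
    using continuous_attains_sup[OF compact_Icc _ contr] T by auto
  then have rX: "\<And>t. T0 \<le> t \<Longrightarrow> t \<le> T1 \<Longrightarrow> r t \<le> r tm" by auto
  define X where "X = max 0 (r tm)"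
  have X: "X \<ge> 0" "\<And>t. T0 \<le> t \<Longrightarrow> t \<le> T1 \<Longrightarrow> r t \<le> X" using rX by (auto simp: X_def intro: max.coboundedI2)
  have cmp: "compact Q"
  proof -
    have c2: "continuous_on ({T0..T1} \<times> {0..X}) (\<lambda>p. r (fst p) - snd p)"
      by (intro continuous_intros continuous_on_compose2[OF contr]) auto
    have "closed (({T0..T1} \<times> {0..X}) \<inter> (\<lambda>p. r (fst p) - snd p) -` {0..})"
      by (rule continuous_closed_preimage[OF c2]) (auto intro: closed_Times)
    moreover have "Q = ({T0..T1} \<times> {0..X}) \<inter> (({T0..T1} \<times> {0..X}) \<inter> (\<lambda>p. r (fst p) - snd p) -` {0..})"
      using X(2) unfolding Q_def by force
    ultimately show ?thesis using compact_Int_closed[OF compact_Times[OF compact_Icc compact_Icc]] by metis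
  qed
  define K where "K = C + 1"
  define \<alpha> where "\<alpha> = exp (- K * t0) * (- z t0 x0)"
  have \<alpha>: "\<alpha> > 0" using neg unfolding \<alpha>_def by (intro mult_pos_pos) auto
  define \<epsilon> where "\<epsilon> = \<alpha> / (X + 1)"
  have \<epsilon>: "\<epsilon> > 0" "\<epsilon> * X < \<alpha>" using \<alpha> X by (auto simp: \<epsilon>_def field_simps)
  define Z where "Z t x = exp (- K * t) * z t x - \<epsilon> * x" for t x
  have "continuous_on Q (\<lambda>p. Z (fst p) (snd p))"
    unfolding Z_def using cont unfolding Q_def by (intro continuous_intros)
  moreover have in0: "(t0, x0) \<in> Q" using pt by (auto simp: Q_def)
  ultimately obtain p where p: "p \<in> Q" "\<And>q. q \<in> Q \<Longrightarrow> Z (fst p) (snd p) \<le> Z (fst q) (snd q)"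
    using continuous_attains_inf[OF cmp] by fast
  define t1 where "t1 = fst p"
  define x1 where "x1 = snd p"
  have tx: "T0 \<le> t1" "t1 \<le> T1" "0 \<le> x1" "x1 \<le> r t1" using p by (auto simp: Q_def t1_def x1_def)
  have min: "Z t1 x1 \<le> Z t x" if "T0 \<le> t" "t \<le> T1" "0 \<le> x" "x \<le> r t" for t x
    using p(2)[of "(t,x)"] that by (auto simp: Q_def t1_def x1_def)
  have "Z t1 x1 \<le> - \<alpha> - \<epsilon> * x0" using min[OF pt] by (simp add: Z_def \<alpha>_def)
  moreover have "\<epsilon> * x1 \<le> \<epsilon> * X" "0 \<le> \<epsilon> * x0" using tx X(2)[of t1] \<epsilon> pt by auto
  ultimately have "exp (- K * t1) * z t1 x1 < 0" using \<epsilon> unfolding Z_def by linarith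
  then have z1: "z t1 x1 < 0" by (simp add: mult_less_0_iff)
  then have t1: "T0 < t1" using init[of x1] tx by (cases "t1 = T0") auto
  have x1: "x1 < r t1" using right[OF t1 tx(2)] z1 tx by (cases "x1 = r t1") auto
  show False
  proof (cases "x1 = 0")
    case True
    then obtain m where m: "m \<le> 0" "(z t1 has_real_derivative m) (at 0 within {0..r t1})"
      using left[OF t1 tx(2)] x1 z1 by auto
    have "(Z t1 has_real_derivative exp (- K * t1) * m - \<epsilon>) (at 0 within {0..r t1})"
      unfolding Z_def by (auto intro!: derivative_eq_intros m(2))
    moreover have "exp (- K * t1) * m - \<epsilon> < 0" using m(1) \<epsilon> by (smt (verit) exp_gt_zero mult_nonneg_nonpos)
    ultimately obtain d where d: "d > 0" "\<And>h. h > 0 \<Longrightarrow> 0 + h \<in> {0..r t1} \<Longrightarrow> h < d \<Longrightarrow> Z t1 0 > Z t1 (0 + h)"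
      using has_real_derivative_neg_dec_right by blast
    define h where "h = min (d/2) (r t1)"
    have "h > 0" "h < d" "h \<le> r t1" using d x1 True by (auto simp: h_def)
    then show False using d(2)[of h] min[of t1 h] tx True by auto
  next
    case False
    then have x1': "0 < x1" using tx by simp
    obtain zt zxx where jet: "jet z t1 x1 zt zxx" and ineq: "C * z t1 x1 \<le> zt - D * zxx"
      using int[OF t1 tx(2) x1' x1 z1] by blast
    have "zt \<le> K * z t1 x1"
    proof (rule ccontr)
      assume gt: "\<not> zt \<le> K * z t1 x1"
      have dz: "((\<lambda>\<tau>. z \<tau> x1) has_real_derivative zt) (at t1)" using jet by (simp add: jet_def)
      have "((\<lambda>\<tau>. Z \<tau> x1) has_real_derivative exp (- K * t1) * (zt - K * z t1 x1)) (at t1)"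
        unfolding Z_def by (auto intro!: derivative_eq_intros dz simp: algebra_simps)
      moreover have "exp (- K * t1) * (zt - K * z t1 x1) > 0" using gt by simp
      ultimately obtain d where d: "d > 0" "\<And>h. h > 0 \<Longrightarrow> h < d \<Longrightarrow> Z (t1 - h) x1 < Z t1 x1"
        using DERIV_pos_inc_left by blast
      have "\<exists>e>0. \<forall>t\<in>{T0..T1}. \<bar>t - t1\<bar> < e \<longrightarrow> \<bar>r t - r t1\<bar> < r t1 - x1"
        using contr x1 tx unfolding continuous_on_iff dist_real_def by (metis atLeastAtMost_iff diff_gt_0_iff_gt)
      then obtain e where e: "e > 0" "\<And>t. t \<in> {T0..T1} \<Longrightarrow> \<bar>t - t1\<bar> < e \<Longrightarrow> \<bar>r t - r t1\<bar> < r t1 - x1" by blast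
      define h where "h = min (min (d/2) (e/2)) (t1 - T0)"
      have h: "h > 0" "h < d" "h < e" "T0 \<le> t1 - h" using d e t1 by (auto simp: h_def)
      have "x1 \<le> r (t1 - h)" using e(2)[of "t1 - h"] h tx by auto
      then show False using min[of "t1 - h" x1] d(2)[of h] h tx by auto
    qed
    moreover have "0 \<le> zxx"
    proof -
      obtain q where q: "\<forall>\<^sub>F y in nhds x1. (z t1 has_real_derivative q y) (at y)" "(q has_real_derivative zxx) (at x1)"
        using jet unfolding jet_def by blast
      have 1: "\<forall>\<^sub>F y in nhds x1. (Z t1 has_real_derivative exp (- K * t1) * q y - \<epsilon>) (at y)"
        using q(1) unfolding Z_def by eventually_elim (auto intro!: derivative_eq_intros)
      have 2: "((\<lambda>y. exp (- K * t1) * q y - \<epsilon>) has_real_derivative exp (- K * t1) * zxx) (at x1)"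
        by (auto intro!: derivative_eq_intros q(2))
      have 3: "\<forall>\<^sub>F y in nhds x1. Z t1 x1 \<le> Z t1 y"
        using eventually_nhds_in_open[of "{0<..<r t1}" x1] x1 x1'
        by (auto elim!: eventually_mono intro!: min tx)
      show ?thesis using second_derivative_nonneg_at_min[OF 1 2 3] by (simp add: zero_le_mult_iff)
    qed
    then have "0 \<le> D * zxx" using D by simp
    ultimately show False using ineq z1 unfolding K_def by (simp add: algebra_simps)
  qed
qed

lemma first_contact:
  fixes \<phi> :: "real \<Rightarrow> real"
  assumes cont: "continuous_on {T..} \<phi>" and pos: "\<phi> T > 0"
    and deriv: "\<And>t. T < t \<Longrightarrow> \<phi> t = 0 \<Longrightarrow> (\<And>\<tau>. T \<le> \<tau> \<Longrightarrow> \<tau> < t \<Longrightarrow> \<phi> \<tau> > 0) \<Longrightarrow>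
      \<exists>y>0. (\<phi> has_real_derivative y) (at t)"
    and t: "T \<le> t"
  shows "\<phi> t > 0"
proof (rule ccontr)
  assume "\<not> \<phi> t > 0"
  let ?A = "{s\<in>{T..t}. \<phi> s \<le> 0}"
  have c: "continuous_on {T..t} \<phi>" using cont by (rule continuous_on_subset) auto
  have "?A = {T..t} \<inter> \<phi> -` {..0}" by auto
  then have "closed ?A"
    using continuous_closed_preimage[OF c closed_atLeastAtMost, of "{..0}"] by simp
  moreover have "?A = {T..t} \<inter> ?A" by auto
  ultimately have "compact ?A" using compact_Int_closed[of "{T..t}" ?A] by simp
  moreover have "?A \<noteq> {}" using \<open>\<not> \<phi> t > 0\<close> t by auto
  ultimately obtain s where s: "s \<in> ?A" "\<And>r. r \<in> ?A \<Longrightarrow> s \<le> r"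
    using compact_attains_inf[of ?A] by blast
  have before: "\<phi> r > 0" if "T \<le> r" "r < s" for r using s(1) s(2)[of r] that by force
  have Ts: "T < s" using s(1) pos by (cases "s = T") auto
  have "\<phi> s = 0"
  proof (rule ccontr)
    assume "\<phi> s \<noteq> 0"
    then have "\<phi> s < 0" using s(1) by auto
    then obtain r where "T \<le> r" "r \<le> s" "\<phi> r = 0"
      using IVT2'[of \<phi> s 0 T] pos Ts continuous_on_subset[OF c, of "{T..s}"] s(1) by auto
    then show False using before[of r] \<open>\<phi> s \<noteq> 0\<close> by (cases "r = s") auto
  qed
  then obtain y where y: "y > 0" "(\<phi> has_real_derivative y) (at s)" using deriv[OF Ts] before by blast
  obtain d where d: "d > 0" "\<And>h. h > 0 \<Longrightarrow> h < d \<Longrightarrow> \<phi> (s - h) < \<phi> s"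
    using DERIV_pos_inc_left[OF y(2,1)] by blast
  define h where "h = min (d/2) (s - T)"
  have "h > 0" "h < d" "T \<le> s - h" using d Ts by (auto simp: h_def)
  then show False using d(2)[of h] before[of "s - h"] \<open>\<phi> s = 0\<close> by auto
qed

lemma derivative_nonpos_at_right_end_min:
  fixes f :: "real \<Rightarrow> real"
  assumes "(f has_real_derivative p) (at b within {a..b})" "a < b" "\<And>y. a \<le> y \<Longrightarrow> y \<le> b \<Longrightarrow> f b \<le> f y"
  shows "p \<le> 0"
proof (rule ccontr)
  assume "\<not> p \<le> 0"
  then obtain d where d: "d > 0" "\<And>h. h > 0 \<Longrightarrow> b - h \<in> {a..b} \<Longrightarrow> h < d \<Longrightarrow> f (b - h) < f b"
    using has_real_derivative_pos_inc_left[OF assms(1)] by auto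
  define h where "h = min (d/2) (b - a)"
  have "h > 0" "h < d" "a \<le> b - h" using d assms(2) by (auto simp: h_def)
  then show False using d(2)[of h] assms(3)[of "b - h"] by auto
qed

lemma continuous_on_quadrant_bounded:
  fixes c :: "real \<Rightarrow> real \<Rightarrow> real"
  assumes "continuous_on {p. 0 \<le> fst p \<and> 0 \<le> snd p} (\<lambda>p. c (fst p) (snd p))"
  shows "\<exists>B\<ge>0. \<forall>t x. 0 \<le> t \<longrightarrow> t \<le> T \<longrightarrow> 0 \<le> x \<longrightarrow> x \<le> X \<longrightarrow> \<bar>c t x\<bar> \<le> B"
proof -
  have "compact ({0..T} \<times> {0..X})" by (intro compact_Times compact_Icc)
  moreover have "continuous_on ({0..T} \<times> {0..X}) (\<lambda>p. c (fst p) (snd p))"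
    using assms by (rule continuous_on_subset) auto
  ultimately have "bounded ((\<lambda>p. c (fst p) (snd p)) ` ({0..T} \<times> {0..X}))"
    using compact_continuous_image compact_imp_bounded by blast
  then obtain B where "\<forall>p\<in>{0..T} \<times> {0..X}. norm (c (fst p) (snd p)) \<le> B"
    unfolding bounded_iff by auto
  then show ?thesis by (intro exI[of _ "max 0 B"]) (force simp: le_max_iff_disj)
qed

locale free_boundary =
  fixes D m :: real and F :: "real \<Rightarrow> real \<Rightarrow> real" and s0 :: real and w0 :: "real \<Rightarrow> real"
    and w :: "real \<Rightarrow> real \<Rightarrow> real" and s :: "real \<Rightarrow> real"
  assumes comp: "fb_component D m F s0 w0 w s"
    and D_pos: "D > 0" and m_pos: "m > 0" and s0_pos: "s0 > 0"
begin

lemma cont_w: "continuous_on {p. 0 \<le> fst p \<and> 0 \<le> snd p} (\<lambda>p. w (fst p) (snd p))"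
  using comp unfolding fb_component_def by blast

lemma cont_s: "continuous_on {0..} s"
  using comp unfolding fb_component_def by blast

lemma cont_w_space:
  assumes "0 \<le> t"
  shows "continuous_on {0..} (w t)"
proof -
  have "continuous_on {0..} (\<lambda>x. w (fst (t, x)) (snd (t, x)))"
    by (rule continuous_on_compose2[OF cont_w]) (use assms in \<open>auto intro!: continuous_on_Pair continuous_on_const continuous_on_id\<close>)
  then show ?thesis by simp
qed

lemma zero_beyond: "0 \<le> t \<Longrightarrow> s t \<le> x \<Longrightarrow> w t x = 0"
  using comp unfolding fb_component_def by blast

lemma w_init: "0 \<le> x \<Longrightarrow> w 0 x = w0 x"
  using comp unfolding fb_component_def by blast

lemma s_init: "s 0 = s0"
  using comp unfolding fb_component_def by blast

lemma classical_derivatives: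
  obtains wt wx wxx s' where
    "\<forall>t>0. (s has_real_derivative s' t) (at t)"
    "\<forall>t>0. \<forall>x\<in>{0..s t}. ((\<lambda>y. w t y) has_real_derivative wx t x) (at x within {0..s t})"
    "\<forall>t>0. \<forall>x. 0 < x \<and> x < s t \<longrightarrow>
            ((\<lambda>y. wx t y) has_real_derivative wxx t x) (at x) \<and>
            ((\<lambda>\<tau>. w \<tau> x) has_real_derivative wt t x) (at t)"
    "\<forall>t>0. \<forall>x. 0 < x \<and> x < s t \<longrightarrow> wt t x - D * wxx t x = F t x"
    "\<forall>t>0. wx t 0 = 0" "\<forall>t>0. s' t = - m * wx t (s t)"
  using comp unfolding fb_component_def by (elim exE conjE) (rule that)

lemma w_neumann:
  assumes "0 < t" "0 \<le> s t"
  shows "(w t has_real_derivative 0) (at 0 within {0..s t})"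
proof -
  obtain wx where "\<forall>t>0. \<forall>x\<in>{0..s t}. ((\<lambda>y. w t y) has_real_derivative wx t x) (at x within {0..s t})"
    "\<forall>t>0. wx t 0 = 0"
    by (rule classical_derivatives)
  then show ?thesis using assms by (metis atLeastAtMost_iff order_refl)
qed

lemma w_front:
  assumes "0 < t" "0 \<le> s t"
  obtains p where "(w t has_real_derivative p) (at (s t) within {0..s t})" "(s has_real_derivative - m * p) (at t)"
proof -
  obtain wx s' where wx: "\<forall>t>0. \<forall>x\<in>{0..s t}. ((\<lambda>y. w t y) has_real_derivative wx t x) (at x within {0..s t})"
    "\<forall>t>0. (s has_real_derivative s' t) (at t)" "\<forall>t>0. s' t = - m * wx t (s t)"
    by (rule classical_derivatives)
  show thesis
  proof (rule that[of "wx t (s t)"])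
    show "(w t has_real_derivative wx t (s t)) (at (s t) within {0..s t})" using wx(1) assms by auto
    show "(s has_real_derivative - m * wx t (s t)) (at t)" using wx(2,3) assms by metis
  qed
qed

lemma w_jet:
  assumes "0 < t" "0 < x" "x < s t"
  obtains wt wxx where "jet w t x wt wxx" "wt - D * wxx = F t x"
proof -
  obtain wt wx wxx where d: "\<forall>t>0. \<forall>x\<in>{0..s t}. ((\<lambda>y. w t y) has_real_derivative wx t x) (at x within {0..s t})"
    "\<forall>t>0. \<forall>x. 0 < x \<and> x < s t \<longrightarrow>
            ((\<lambda>y. wx t y) has_real_derivative wxx t x) (at x) \<and>
            ((\<lambda>\<tau>. w \<tau> x) has_real_derivative wt t x) (at t)"
    "\<forall>t>0. \<forall>x. 0 < x \<and> x < s t \<longrightarrow> wt t x - D * wxx t x = F t x"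
    by (rule classical_derivatives)
  have "\<forall>\<^sub>F y in nhds x. (w t has_real_derivative wx t y) (at y)"
    using eventually_nhds_in_open[of "{0<..<s t}" x] assms
  proof (auto elim!: eventually_mono)
    fix y assume y: "0 < y" "y < s t"
    then have "(w t has_real_derivative wx t y) (at y within {0..s t})" using d(1) assms by auto
    then show "(w t has_real_derivative wx t y) (at y)" using at_within_Icc_at[of 0 y "s t"] y by simp
  qed
  then have "jet w t x (wt t x) (wxx t x)"
    unfolding jet_def using d(2) assms by blast
  then show thesis using that d(3) assms by blast
qed

lemma cont_w_below:
  assumes "0 \<le> T"
  shows "continuous_on {p. T \<le> fst p \<and> fst p \<le> T1 \<and> 0 \<le> snd p \<and> snd p \<le> r (fst p)} (\<lambda>p. w (fst p) (snd p))"
  using cont_w by (rule continuous_on_subset) (use assms in auto)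

lemma nonneg_of_linear_reaction:
  assumes F: "\<And>t x. F t x = w t x * c t x"
    and c: "continuous_on {p. 0 \<le> fst p \<and> 0 \<le> snd p} (\<lambda>p. c (fst p) (snd p))"
    and w0: "\<And>x. 0 \<le> x \<Longrightarrow> 0 \<le> w0 x" and tx: "0 \<le> t" "0 \<le> x"
  shows "0 \<le> w t x"
proof (cases "x \<le> s t")
  case False
  then show ?thesis using zero_beyond tx by simp
next
  case True
  have cs: "continuous_on {0..t} s" using cont_s by (rule continuous_on_subset) auto
  obtain tm where tm: "\<And>\<tau>. \<tau> \<in> {0..t} \<Longrightarrow> s \<tau> \<le> s tm"
    using continuous_attains_sup[OF compact_Icc _ cs] tx by force
  obtain B where B: "\<And>\<tau> y. 0 \<le> \<tau> \<Longrightarrow> \<tau> \<le> t \<Longrightarrow> 0 \<le> y \<Longrightarrow> y \<le> s tm \<Longrightarrow> \<bar>c \<tau> y\<bar> \<le> B"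
    using continuous_on_quadrant_bounded[OF c] by metis
  show ?thesis
  proof (rule minimum_principle[where z=w and r=s and ?T0.0=0 and ?T1.0=t and D=D and C=B and ?t0.0=t and ?x0.0=x])
    show "\<exists>wt wxx. jet w \<tau> y wt wxx \<and> B * w \<tau> y \<le> wt - D * wxx"
      if \<tau>: "0 < \<tau>" "\<tau> \<le> t" "0 < y" "y < s \<tau>" "w \<tau> y < 0" for \<tau> y
    proof -
      obtain wt wxx where j: "jet w \<tau> y wt wxx" "wt - D * wxx = F \<tau> y" using w_jet[of \<tau> y] \<tau> by auto
      have "\<bar>c \<tau> y\<bar> \<le> B" using B[of \<tau> y] tm[of \<tau>] that by auto
      then have "B * w \<tau> y \<le> c \<tau> y * w \<tau> y" using that by (intro mult_right_mono_neg) auto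
      then show ?thesis using j F by (metis mult.commute)
    qed
    show "0 \<le> w \<tau> 0 \<or> (\<exists>p\<le>0. (w \<tau> has_real_derivative p) (at 0 within {0..s \<tau>}))"
      if "0 < \<tau>" "\<tau> \<le> t" "0 < s \<tau>" for \<tau>
      using w_neumann[of \<tau>] that by auto
    show "0 \<le> w 0 y" if "0 \<le> y" for y using w_init[OF that] w0[OF that] by simp
    show "0 \<le> w \<tau> (s \<tau>)" if "0 < \<tau>" for \<tau> using zero_beyond[of \<tau> "s \<tau>"] that by simp
  qed (fact D_pos cs tx True order_refl cont_w_below[OF order_refl])+
qed

end

locale positive_free_boundary = free_boundary +
  assumes w_nonneg: "\<And>t x. 0 \<le> t \<Longrightarrow> 0 \<le> x \<Longrightarrow> 0 \<le> w t x"
begin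

lemma s_deriv_nonneg:
  assumes "0 < t" "0 < s t"
  shows "\<exists>y\<ge>0. (s has_real_derivative y) (at t)"
proof -
  obtain p where p: "(w t has_real_derivative p) (at (s t) within {0..s t})" "(s has_real_derivative - m * p) (at t)"
    using w_front[of t] assms by auto
  have "p \<le> 0"
    using derivative_nonpos_at_right_end_min[OF p(1)] w_nonneg[of t] zero_beyond[of t "s t"] assms by auto
  then show ?thesis using p(2) m_pos by (intro exI[of _ "- m * p"]) (auto simp: mult_nonneg_nonpos)
qed

lemma s_ge: "0 \<le> t \<Longrightarrow> s0 \<le> s t"
  using nondecreasing_while_positive[of 0 t s] s_deriv_nonneg s_init s0_pos
    continuous_on_subset[OF cont_s, of "{0..t}"] by auto

lemma s_pos: "0 \<le> t \<Longrightarrow> 0 < s t"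
  using s_ge s0_pos by (meson less_le_trans)

lemma s_mono:
  assumes "0 \<le> t1" "t1 \<le> t2"
  shows "s t1 \<le> s t2"
proof (rule DERIV_nonneg_imp_increasing_open[OF assms(2)])
  show "continuous_on {t1..t2} s" using cont_s by (rule continuous_on_subset) (use assms in auto)
  show "\<exists>y. (s has_real_derivative y) (at x) \<and> 0 \<le> y" if "t1 < x" "x < t2" for x
    using s_deriv_nonneg[of x] s_pos[of x] that assms by auto
qed

text \<open>
  At a first contact of the fronts the space derivatives are ordered there; the strict inequality
  for the speed of \<open>\<sigma>\<close> then excludes contact without the Hopf lemma.
\<close>

lemma below_supersolution:
  fixes W :: "real \<Rightarrow> real \<Rightarrow> real" and \<sigma> \<sigma>' :: "real \<Rightarrow> real"
  assumes T: "0 \<le> T"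
    and \<sigma>: "continuous_on {T..} \<sigma>" "\<And>t. T < t \<Longrightarrow> (\<sigma> has_real_derivative \<sigma>' t) (at t)"
    and W_cont: "continuous_on {p. T \<le> fst p \<and> 0 \<le> snd p \<and> snd p \<le> \<sigma> (fst p)} (\<lambda>p. W (fst p) (snd p))"
    and W_nonneg: "\<And>t x. T \<le> t \<Longrightarrow> 0 \<le> x \<Longrightarrow> x \<le> \<sigma> t \<Longrightarrow> 0 \<le> W t x"
    and W_front: "\<And>t. T < t \<Longrightarrow> W t (\<sigma> t) = 0"
    and W_speed: "\<And>t. T < t \<Longrightarrow> 0 < \<sigma> t \<Longrightarrow> \<exists>l. (W t has_real_derivative l) (at (\<sigma> t) within {0..\<sigma> t}) \<and> - m * l < \<sigma>' t"
    and W_left: "\<And>t. T < t \<Longrightarrow> 0 < \<sigma> t \<Longrightarrow> \<exists>p\<le>0. (W t has_real_derivative p) (at 0 within {0..\<sigma> t})"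
    and W_super: "\<And>t x. T < t \<Longrightarrow> 0 < x \<Longrightarrow> x < s t \<Longrightarrow> s t \<le> \<sigma> t \<Longrightarrow> W t x < w t x \<Longrightarrow>
       \<exists>Wt Wxx. jet W t x Wt Wxx \<and> C * (W t x - w t x) \<le> Wt - D * Wxx - F t x"
    and init: "s T < \<sigma> T" "\<And>x. 0 \<le> x \<Longrightarrow> x \<le> s T \<Longrightarrow> w T x \<le> W T x"
    and t: "T \<le> t"
  shows "s t < \<sigma> t"
proof -
  have below: "w \<tau> x \<le> W \<tau> x" if le: "\<And>r. T \<le> r \<Longrightarrow> r \<le> \<tau> \<Longrightarrow> s r \<le> \<sigma> r" and \<tau>: "T \<le> \<tau>" "0 \<le> x" "x \<le> s \<tau>" for \<tau> x
  proof -
    have "0 \<le> W \<tau> x - w \<tau> x"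
    proof (rule minimum_principle[where z="\<lambda>t x. W t x - w t x" and r=s and ?T0.0=T and ?T1.0=\<tau> and D=D and C=C])
      show "continuous_on {p. T \<le> fst p \<and> fst p \<le> \<tau> \<and> 0 \<le> snd p \<and> snd p \<le> s (fst p)}
        (\<lambda>p. W (fst p) (snd p) - w (fst p) (snd p))"
        by (intro continuous_intros cont_w_below T continuous_on_subset[OF W_cont]) (use le in force)
      show "continuous_on {T..\<tau>} s" using cont_s by (rule continuous_on_subset) (use T in auto)
      show "0 \<le> W r (s r) - w r (s r)" if "T < r" "r \<le> \<tau>" "0 \<le> s r" for r
        using W_nonneg[of r "s r"] le[of r] zero_beyond[of r "s r"] that T by auto
      show "0 \<le> W r 0 - w r 0 \<or> (\<exists>p\<le>0. ((\<lambda>x. W r x - w r x) has_real_derivative p) (at 0 within {0..s r}))"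
        if r: "T < r" "r \<le> \<tau>" "0 < s r" for r
      proof -
        obtain p where p: "p \<le> 0" "(W r has_real_derivative p) (at 0 within {0..\<sigma> r})"
          using W_left[of r] le[of r] r by auto
        have "(W r has_real_derivative p) (at 0 within {0..s r})"
          using p(2) by (rule DERIV_subset) (use le[of r] r in auto)
        then have "((\<lambda>x. W r x - w r x) has_real_derivative p - 0) (at 0 within {0..s r})"
          using w_neumann[of r] r T by (intro DERIV_diff) auto
        then show ?thesis using p(1) by auto
      qed
      show "\<exists>zt zxx. jet (\<lambda>t x. W t x - w t x) r y zt zxx \<and> C * (W r y - w r y) \<le> zt - D * zxx"
        if r: "T < r" "r \<le> \<tau>" "0 < y" "y < s r" "W r y - w r y < 0" for r y
      proof -
        obtain Wt Wxx where W: "jet W r y Wt Wxx" "C * (W r y - w r y) \<le> Wt - D * Wxx - F r y"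
          using W_super[of r y] le[of r] r by auto
        obtain wt wxx where w: "jet w r y wt wxx" "wt - D * wxx = F r y"
          using w_jet[of r y] r T by auto
        show ?thesis using jet_diff[OF W(1) w(1)] W(2) w(2)
          by (intro exI[of _ "Wt - wt"] exI[of _ "Wxx - wxx"]) (simp add: algebra_simps)
      qed
    qed (use D_pos init \<tau> in auto)
    then show ?thesis by simp
  qed
  have "0 < \<sigma> t - s t"
  proof (rule first_contact[where \<phi>="\<lambda>t. \<sigma> t - s t" and T=T])
    show "continuous_on {T..} (\<lambda>t. \<sigma> t - s t)"
      using \<sigma>(1) continuous_on_subset[OF cont_s, of "{T..}"] T by (intro continuous_intros) auto
    fix r assume r: "T < r" "\<sigma> r - s r = 0" "\<And>\<tau>. T \<le> \<tau> \<Longrightarrow> \<tau> < r \<Longrightarrow> 0 < \<sigma> \<tau> - s \<tau>"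
    have le: "s \<tau> \<le> \<sigma> \<tau>" if "T \<le> \<tau>" "\<tau> \<le> r" for \<tau>
      using r(2) r(3)[of \<tau>] that by (cases "\<tau> = r") auto
    have sr: "\<sigma> r = s r" "0 < s r" using r s_pos[of r] T by auto
    obtain l where l: "(W r has_real_derivative l) (at (s r) within {0..s r})" "- m * l < \<sigma>' r"
      using W_speed[OF r(1)] sr by auto
    obtain p where p: "(w r has_real_derivative p) (at (s r) within {0..s r})" "(s has_real_derivative - m * p) (at r)"
      using w_front[of r] r T sr by auto
    have "l - p \<le> 0"
      using derivative_nonpos_at_right_end_min[OF DERIV_diff[OF l(1) p(1)]] below[OF le, of r]
        W_front[OF r(1)] zero_beyond[of r "s r"] sr r T by auto
    then have "m * l \<le> m * p" using m_pos by simp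
    then show "\<exists>y>0. ((\<lambda>t. \<sigma> t - s t) has_real_derivative y) (at r)"
      using DERIV_diff[OF \<sigma>(2)[OF r(1)] p(2)] l(2) by (intro exI[of _ "\<sigma>' r - - m * p"]) auto
  qed (use init t in auto)
  then show ?thesis by simp
qed

lemma above_subsolution:
  fixes V :: "real \<Rightarrow> real \<Rightarrow> real" and \<sigma> \<sigma>' :: "real \<Rightarrow> real"
  assumes T: "0 \<le> T"
    and \<sigma>: "continuous_on {T..} \<sigma>" "\<And>t. T < t \<Longrightarrow> (\<sigma> has_real_derivative \<sigma>' t) (at t)"
    and V_cont: "continuous_on {p. T \<le> fst p \<and> 0 \<le> snd p \<and> snd p \<le> \<sigma> (fst p)} (\<lambda>p. V (fst p) (snd p))"
    and V_front: "\<And>t. T < t \<Longrightarrow> V t (\<sigma> t) = 0"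
    and V_speed: "\<And>t. T < t \<Longrightarrow> 0 < \<sigma> t \<Longrightarrow> \<exists>l. (V t has_real_derivative l) (at (\<sigma> t) within {0..\<sigma> t}) \<and> \<sigma>' t < - m * l"
    and V_left: "\<And>t. T < t \<Longrightarrow> V t 0 \<le> w t 0"
    and V_sub: "\<And>t x. T < t \<Longrightarrow> 0 < x \<Longrightarrow> x < \<sigma> t \<Longrightarrow> \<sigma> t \<le> s t \<Longrightarrow> w t x < V t x \<Longrightarrow>
       \<exists>Vt Vxx. jet V t x Vt Vxx \<and> C * (w t x - V t x) \<le> F t x - (Vt - D * Vxx)"
    and init: "\<sigma> T < s T" "\<And>x. 0 \<le> x \<Longrightarrow> x \<le> \<sigma> T \<Longrightarrow> V T x \<le> w T x"
    and t: "T \<le> t"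
  shows "\<sigma> t < s t" "0 \<le> x \<Longrightarrow> x \<le> \<sigma> t \<Longrightarrow> V t x \<le> w t x"
proof -
  have above: "V \<tau> x \<le> w \<tau> x" if le: "\<And>r. T \<le> r \<Longrightarrow> r \<le> \<tau> \<Longrightarrow> \<sigma> r \<le> s r" and \<tau>: "T \<le> \<tau>" "0 \<le> x" "x \<le> \<sigma> \<tau>" for \<tau> x
  proof -
    have "0 \<le> w \<tau> x - V \<tau> x"
    proof (rule minimum_principle[where z="\<lambda>t x. w t x - V t x" and r=\<sigma> and ?T0.0=T and ?T1.0=\<tau> and D=D and C=C])
      show "continuous_on {p. T \<le> fst p \<and> fst p \<le> \<tau> \<and> 0 \<le> snd p \<and> snd p \<le> \<sigma> (fst p)}
        (\<lambda>p. w (fst p) (snd p) - V (fst p) (snd p))"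
        by (intro continuous_intros cont_w_below T continuous_on_subset[OF V_cont]) auto
      show "continuous_on {T..\<tau>} \<sigma>" using \<sigma>(1) by (rule continuous_on_subset) auto
      show "0 \<le> w r (\<sigma> r) - V r (\<sigma> r)" if "T < r" "r \<le> \<tau>" "0 \<le> \<sigma> r" for r
        using V_front[of r] w_nonneg[of r "\<sigma> r"] that T by auto
      show "0 \<le> w r 0 - V r 0 \<or> (\<exists>p\<le>0. ((\<lambda>x. w r x - V r x) has_real_derivative p) (at 0 within {0..\<sigma> r}))"
        if "T < r" "r \<le> \<tau>" "0 < \<sigma> r" for r
        using V_left[of r] that by simp
      show "\<exists>zt zxx. jet (\<lambda>t x. w t x - V t x) r y zt zxx \<and> C * (w r y - V r y) \<le> zt - D * zxx"
        if r: "T < r" "r \<le> \<tau>" "0 < y" "y < \<sigma> r" "w r y - V r y < 0" for r y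
      proof -
        obtain Vt Vxx where V: "jet V r y Vt Vxx" "C * (w r y - V r y) \<le> F r y - (Vt - D * Vxx)"
          using V_sub[of r y] le[of r] r by auto
        obtain wt wxx where w: "jet w r y wt wxx" "wt - D * wxx = F r y"
          using w_jet[of r y] r T le[of r] by auto
        show ?thesis using jet_diff[OF w(1) V(1)] V(2) w(2)
          by (intro exI[of _ "wt - Vt"] exI[of _ "wxx - Vxx"]) (simp add: algebra_simps)
      qed
    qed (use D_pos init \<tau> in auto)
    then show ?thesis by simp
  qed
  have front: "0 < s t - \<sigma> t" if "T \<le> t" for t
  proof (rule first_contact[where \<phi>="\<lambda>t. s t - \<sigma> t" and T=T])
    show "continuous_on {T..} (\<lambda>t. s t - \<sigma> t)"
      using \<sigma>(1) continuous_on_subset[OF cont_s, of "{T..}"] T by (intro continuous_intros) auto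
    fix r assume r: "T < r" "s r - \<sigma> r = 0" "\<And>\<tau>. T \<le> \<tau> \<Longrightarrow> \<tau> < r \<Longrightarrow> 0 < s \<tau> - \<sigma> \<tau>"
    have le: "\<sigma> \<tau> \<le> s \<tau>" if "T \<le> \<tau>" "\<tau> \<le> r" for \<tau>
      using r(2) r(3)[of \<tau>] that by (cases "\<tau> = r") auto
    have sr: "\<sigma> r = s r" "0 < s r" using r s_pos[of r] T by auto
    obtain l where l: "(V r has_real_derivative l) (at (s r) within {0..s r})" "\<sigma>' r < - m * l"
      using V_speed[OF r(1)] sr by auto
    obtain p where p: "(w r has_real_derivative p) (at (s r) within {0..s r})" "(s has_real_derivative - m * p) (at r)"
      using w_front[of r] r T sr by auto
    have "p - l \<le> 0"
      using derivative_nonpos_at_right_end_min[OF DERIV_diff[OF p(1) l(1)]] above[OF le, of r]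
        V_front[OF r(1)] zero_beyond[of r "s r"] sr r T by auto
    then have "m * p \<le> m * l" using m_pos by simp
    then show "\<exists>y>0. ((\<lambda>t. s t - \<sigma> t) has_real_derivative y) (at r)"
      using DERIV_diff[OF p(2) \<sigma>(2)[OF r(1)]] l(2) by (intro exI[of _ "- m * p - \<sigma>' r"]) auto
  qed (use init that in auto)
  from front[OF t] show "\<sigma> t < s t" by simp
  have "\<sigma> r \<le> s r" if "T \<le> r" for r using front[OF that] by simp
  then show "V t x \<le> w t x" if "0 \<le> x" "x \<le> \<sigma> t"
    using above[OF _ t that] by simp
qed

lemma front_bounded_of_decay:
  assumes T: "0 \<le> T" and \<kappa>: "\<kappa> > 0"
    and F: "\<And>t x. T < t \<Longrightarrow> 0 < x \<Longrightarrow> x < s t \<Longrightarrow> F t x \<le> - \<kappa> * w t x"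
  shows "\<exists>L. (s \<longlongrightarrow> L) at_top"
proof -
  obtain B where B: "B \<ge> 0" "\<And>t x. 0 \<le> t \<Longrightarrow> t \<le> T \<Longrightarrow> 0 \<le> x \<Longrightarrow> x \<le> s T \<Longrightarrow> \<bar>w t x\<bar> \<le> B"
    using continuous_on_quadrant_bounded[OF cont_w] by metis
  define M where "M = 2 * B + 1"
  define G where "G = 2 * s T + 2 * m * M / \<kappa> + 1"
  have sT: "s T > 0" using s_pos T by simp
  have M: "M > 0" using B by (simp add: M_def)
  have "2 * m * M / \<kappa> \<ge> 0" using M m_pos \<kappa> by simp
  then have G: "G \<ge> 2 * s T" "G \<ge> 1" "G > 2 * m * M / \<kappa>" using sT by (auto simp: G_def)
  define e where "e t = exp (- \<kappa> * (t - T))" for t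
  define \<sigma> where "\<sigma> t = G * (2 - e t)" for t
  define W where "W t x = M * e t * (1 - x\<^sup>2 / (\<sigma> t)\<^sup>2)" for t x
  have e: "0 < e t" "T \<le> t \<Longrightarrow> e t \<le> 1" for t using \<kappa> by (auto simp: e_def)
  have de: "(e has_real_derivative - \<kappa> * e t) (at t)" for t
    unfolding e_def by (auto intro!: derivative_eq_intros)
  have \<sigma>_ge: "G \<le> \<sigma> t" if "T \<le> t" for t
  proof -
    have "G * 1 \<le> \<sigma> t" unfolding \<sigma>_def using e(2)[OF that] G by (intro mult_left_mono) auto
    then show ?thesis by simp
  qed
  have \<sigma>_pos: "0 < \<sigma> t" if "T \<le> t" for t using \<sigma>_ge[OF that] G by simp
  have \<sigma>_le: "\<sigma> t \<le> 2 * G" for t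
  proof -
    have "G * (2 - e t) \<le> G * 2" using e(1)[of t] G by (intro mult_left_mono) auto
    then show ?thesis by (simp add: \<sigma>_def)
  qed
  have d\<sigma>: "(\<sigma> has_real_derivative G * \<kappa> * e t) (at t)" for t
    unfolding \<sigma>_def by (auto intro!: derivative_eq_intros de)
  have ce: "continuous_on S e" for S unfolding e_def by (intro continuous_intros)
  have c\<sigma>: "continuous_on S \<sigma>" for S unfolding \<sigma>_def by (intro continuous_intros ce)
  have dWx: "(W t has_real_derivative M * e t * (- 2 * x / (\<sigma> t)\<^sup>2)) (at x within S)" if "T \<le> t" for t x S
    unfolding W_def using \<sigma>_pos[OF that]
    by (auto intro!: derivative_eq_intros simp: field_simps power2_eq_square power4_eq_xxxx)
  have below: "s t < \<sigma> t" if "T \<le> t" for t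
  proof (rule below_supersolution[where W=W and \<sigma>=\<sigma> and \<sigma>'="\<lambda>t. G * \<kappa> * e t" and T=T and C=0])
    show "continuous_on {p. T \<le> fst p \<and> 0 \<le> snd p \<and> snd p \<le> \<sigma> (fst p)} (\<lambda>p. W (fst p) (snd p))"
    proof -
      have "\<sigma> (fst p) \<noteq> 0" if "T \<le> fst p" for p :: "real \<times> real" using \<sigma>_pos[OF that] by simp
      then show ?thesis unfolding W_def
        by (intro continuous_intros continuous_on_compose2[OF ce[of UNIV]] continuous_on_compose2[OF c\<sigma>[of UNIV]]) auto
    qed
    show "0 \<le> W t x" if "T \<le> t" "0 \<le> x" "x \<le> \<sigma> t" for t x
    proof -
      have "x\<^sup>2 \<le> (\<sigma> t)\<^sup>2" using that by (intro power_mono) auto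
      then have "x\<^sup>2 / (\<sigma> t)\<^sup>2 \<le> 1" using \<sigma>_pos[OF that(1)] by simp
      then show ?thesis using M e(1)[of t] by (simp add: W_def)
    qed
    show "W t (\<sigma> t) = 0" if "T < t" for t using \<sigma>_pos[of t] that by (simp add: W_def)
    show "\<exists>l. (W t has_real_derivative l) (at (\<sigma> t) within {0..\<sigma> t}) \<and> - m * l < G * \<kappa> * e t" if "T < t" for t
    proof (intro exI conjI)
      show "(W t has_real_derivative M * e t * (- 2 * \<sigma> t / (\<sigma> t)\<^sup>2)) (at (\<sigma> t) within {0..\<sigma> t})"
        using dWx that by simp
      have "- m * (M * e t * (- 2 * \<sigma> t / (\<sigma> t)\<^sup>2)) = 2 * m * M * e t / \<sigma> t"
        using \<sigma>_pos[of t] that by (simp add: power2_eq_square)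
      also have "\<dots> \<le> 2 * m * M * e t / 1"
        using \<sigma>_ge[of t] G that m_pos M e(1)[of t] by (intro divide_left_mono) auto
      also have "\<dots> < G * \<kappa> * e t"
        using G(3) \<kappa> e(1)[of t] by (simp add: field_simps)
      finally show "- m * (M * e t * (- 2 * \<sigma> t / (\<sigma> t)\<^sup>2)) < G * \<kappa> * e t" .
    qed
    show "\<exists>p\<le>0. (W t has_real_derivative p) (at 0 within {0..\<sigma> t})" if "T < t" for t
      using dWx[of t 0 "{0..\<sigma> t}"] that by (intro exI[of _ 0]) simp
    show "s T < \<sigma> T" using \<sigma>_ge[of T] G sT by simp
    show "w T x \<le> W T x" if x: "0 \<le> x" "x \<le> s T" for x
    proof -
      have "x \<le> \<sigma> T / 2" using \<sigma>_ge[of T] G x by simp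
      then have "x\<^sup>2 \<le> (\<sigma> T / 2)\<^sup>2" using x by (intro power_mono) auto
      then have "x\<^sup>2 / (\<sigma> T)\<^sup>2 \<le> 1/4" using \<sigma>_pos[of T] by (simp add: field_simps power2_eq_square)
      then have "M * (1/2) \<le> M * (1 - x\<^sup>2 / (\<sigma> T)\<^sup>2)" using M by (intro mult_left_mono) linarith+
      then have "M / 2 \<le> W T x" by (simp add: W_def e_def)
      moreover have "w T x \<le> B" using B(2)[of T x] T x by auto
      ultimately show ?thesis by (simp add: M_def)
    qed
    show "\<exists>Wt Wxx. jet W t x Wt Wxx \<and> 0 * (W t x - w t x) \<le> Wt - D * Wxx - F t x"
      if tx: "T < t" "0 < x" "x < s t" "s t \<le> \<sigma> t" "W t x < w t x" for t x
    proof -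
      define Wt where "Wt = - \<kappa> * W t x + M * e t * (2 * x\<^sup>2 * (G * \<kappa> * e t) / (\<sigma> t)^3)"
      define Wxx where "Wxx = M * e t * (- 2 / (\<sigma> t)\<^sup>2)"
      have \<sigma>t: "\<sigma> t > 0" using \<sigma>_pos[of t] tx by simp
      have "jet W t x Wt Wxx" unfolding jet_def
      proof (intro conjI exI)
        have "((\<lambda>\<tau>. 1 - x\<^sup>2 / (\<sigma> \<tau>)\<^sup>2) has_real_derivative 2 * x\<^sup>2 * (G * \<kappa> * e t) / (\<sigma> t)^3) (at t)"
          using \<sigma>t by (auto intro!: derivative_eq_intros d\<sigma> simp: field_simps power2_eq_square power3_eq_cube)
        from DERIV_mult[OF DERIV_cmult[OF de, of M] this]
        show "((\<lambda>\<tau>. W \<tau> x) has_real_derivative Wt) (at t)"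
          unfolding W_def Wt_def by (simp add: algebra_simps)
        show "\<forall>\<^sub>F y in nhds x. (W t has_real_derivative M * e t * (- 2 * y / (\<sigma> t)\<^sup>2)) (at y)"
          using dWx tx by (intro always_eventually allI) auto
        show "((\<lambda>y. M * e t * (- 2 * y / (\<sigma> t)\<^sup>2)) has_real_derivative Wxx) (at x)"
          unfolding Wxx_def using \<sigma>t
          by (auto intro!: derivative_eq_intros simp: field_simps power2_eq_square power4_eq_xxxx)
      qed
      moreover have "0 \<le> M * e t * (2 * x\<^sup>2 * (G * \<kappa> * e t) / (\<sigma> t)^3)"
        using M e(1)[of t] G \<kappa> \<sigma>t by simp
      moreover have "D * Wxx \<le> 0" unfolding Wxx_def using M e(1)[of t] D_pos by (simp add: mult_nonneg_nonpos)
      moreover have "F t x \<le> - \<kappa> * w t x" using F tx by blast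
      moreover have "\<kappa> * W t x \<le> \<kappa> * w t x" using tx \<kappa> by simp
      ultimately show ?thesis unfolding Wt_def by fastforce
    qed
  qed (use T c\<sigma> d\<sigma> that in auto)
  have bdd: "bdd_above (s ` {T..})"
  proof (rule bdd_aboveI2)
    show "s t \<le> 2 * G" if "t \<in> {T..}" for t using below[of t] \<sigma>_le[of t] that by simp
  qed
  have "(s \<longlongrightarrow> (SUP t\<in>{T..}. s t)) at_top"
  proof (rule order_tendstoI)
    fix y assume "y < (SUP t\<in>{T..}. s t)"
    then obtain t where t: "T \<le> t" "y < s t" using less_cSUP_iff[OF _ bdd] by auto
    show "\<forall>\<^sub>F r in at_top. y < s r"
      using eventually_ge_at_top[of t]
    proof eventually_elim
      case (elim r)
      then show ?case using s_mono[of t r] t T by auto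
    qed
  next
    fix y assume y: "(SUP t\<in>{T..}. s t) < y"
    show "\<forall>\<^sub>F r in at_top. s r < y"
      using eventually_ge_at_top[of T]
    proof eventually_elim
      case (elim r)
      then show ?case using cSUP_upper[OF _ bdd, of r] y by auto
    qed
  qed
  then show ?thesis by blast
qed

end

section \<open>Fronts of logistic free boundary problems\<close>

lemma jet_time_only:
  assumes "(f has_real_derivative f') (at t)"
  shows "jet (\<lambda>t x. f t) t x f' 0"
  unfolding jet_def using assms by (auto intro!: exI[of _ "\<lambda>_. 0"])

lemma jet_travelling:
  assumes q: "\<And>x. x > 0 \<Longrightarrow> (q has_real_derivative q' x) (at x)"
    and q': "\<And>x. x > 0 \<Longrightarrow> (q' has_real_derivative q'' x) (at x)"
    and \<sigma>: "(\<sigma> has_real_derivative \<sigma>') (at t)" and x: "x < \<sigma> t"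
  shows "jet (\<lambda>t x. A * q (\<sigma> t - x)) t x (A * (q' (\<sigma> t - x) * \<sigma>')) (A * q'' (\<sigma> t - x))"
proof -
  have "((\<lambda>\<tau>. q (\<sigma> \<tau> - x)) has_real_derivative q' (\<sigma> t - x) * (\<sigma>' - 0)) (at t)"
    by (rule DERIV_chain2[where f=q and g="\<lambda>\<tau>. \<sigma> \<tau> - x"]) (use q x DERIV_diff[OF \<sigma> DERIV_const[of x]] in auto)
  then have 1: "((\<lambda>\<tau>. A * q (\<sigma> \<tau> - x)) has_real_derivative A * (q' (\<sigma> t - x) * \<sigma>')) (at t)"
    by (auto intro!: DERIV_cmult)
  have "((\<lambda>y. A * q (\<sigma> t - y)) has_real_derivative - A * q' (\<sigma> t - y)) (at y)" if "y < \<sigma> t" for y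
  proof -
    have "((\<lambda>y. q (\<sigma> t - y)) has_real_derivative q' (\<sigma> t - y) * (0 - 1)) (at y)"
      by (rule DERIV_chain2[where f=q and g="\<lambda>y. \<sigma> t - y"]) (use q that DERIV_diff[OF DERIV_const DERIV_ident] in auto)
    from DERIV_cmult[OF this, of A] show ?thesis by simp
  qed
  then have 2: "\<forall>\<^sub>F y in nhds x. ((\<lambda>y. A * q (\<sigma> t - y)) has_real_derivative - A * q' (\<sigma> t - y)) (at y)"
    using eventually_nhds_in_open[of "{..<\<sigma> t}" x] x by (auto elim!: eventually_mono)
  have "((\<lambda>y. q' (\<sigma> t - y)) has_real_derivative q'' (\<sigma> t - x) * (0 - 1)) (at x)"
    by (rule DERIV_chain2[where f=q' and g="\<lambda>y. \<sigma> t - y"]) (use q' x DERIV_diff[OF DERIV_const DERIV_ident] in auto)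
  from DERIV_cmult[OF this, of "- A"]
  have 3: "((\<lambda>y. - A * q' (\<sigma> t - y)) has_real_derivative A * q'' (\<sigma> t - x)) (at x)" by simp
  show ?thesis unfolding jet_def
    by (intro conjI 1 exI[of _ "\<lambda>y. - A * q' (\<sigma> t - y)"] 2 3)
qed

lemma travelling_space_derivative:
  assumes q: "\<And>x. x \<ge> 0 \<Longrightarrow> (q has_real_derivative q' x) (at x within {0..})" and x: "x \<in> {0..b}"
  shows "((\<lambda>y. A * q (b - y)) has_real_derivative - A * q' (b - x)) (at x within {0..b})"
proof -
  have "(q has_real_derivative q' (b - x)) (at (b - x) within (\<lambda>y. b - y) ` {0..b})"
    by (rule DERIV_subset[OF q]) (use x in auto)
  then have "(q \<circ> (\<lambda>y. b - y) has_real_derivative q' (b - x) * (0 - 1)) (at x within {0..b})"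
    by (rule DERIV_image_chain) (auto intro!: derivative_eq_intros)
  from DERIV_cmult[OF this, of A] show ?thesis by (simp add: o_def)
qed

lemma continuous_on_travelling:
  fixes q :: "real \<Rightarrow> real"
  assumes "continuous_on {0..} q" "continuous_on {T..} \<sigma>"
  shows "continuous_on {p. T \<le> fst p \<and> 0 \<le> snd p \<and> snd p \<le> \<sigma> (fst p)} (\<lambda>p. A * q (\<sigma> (fst p) - snd p))"
  by (intro continuous_intros continuous_on_compose2[OF assms(1)] continuous_on_compose2[OF assms(2)]) auto

lemma logistic_difference:
  fixes y z \<theta> :: real
  assumes "z < y" "0 \<le> y + z"
  shows "\<theta> * (z - y) \<le> z * (\<theta> - z) - y * (\<theta> - y)"
proof -
  have "z * (\<theta> - z) - y * (\<theta> - y) - \<theta> * (z - y) = (y - z) * (y + z)" by (simp add: algebra_simps)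
  also have "\<dots> \<ge> 0" using assms by simp
  finally show ?thesis by simp
qed

locale logistic_below = positive_free_boundary +
  fixes \<theta> :: real
  assumes \<theta>_pos: "\<theta> > 0"
    and F_le: "\<And>t x. 0 \<le> t \<Longrightarrow> 0 \<le> x \<Longrightarrow> F t x \<le> w t x * (\<theta> - w t x)"
begin

lemma eventually_below:
  assumes "\<epsilon> > 0"
  shows "\<exists>T\<ge>0. \<forall>t\<ge>T. \<forall>x\<ge>0. w t x \<le> \<theta> + \<epsilon>"
proof -
  obtain B where B: "B \<ge> 0" "\<And>t x. 0 \<le> t \<Longrightarrow> t \<le> 0 \<Longrightarrow> 0 \<le> x \<Longrightarrow> x \<le> s0 \<Longrightarrow> \<bar>w t x\<bar> \<le> B"
    using continuous_on_quadrant_bounded[OF cont_w] by metis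
  define W where "W t = \<theta> + B * exp (- \<theta> * t)" for t
  have le: "w t x \<le> W t" if tx: "0 \<le> t" "0 \<le> x" for t x
  proof (cases "x \<le> s t")
    case False
    then show ?thesis using zero_beyond[of t x] tx \<theta>_pos B by (auto simp: W_def)
  next
    case True
    have "0 \<le> W t - w t x"
    proof (rule minimum_principle[where z="\<lambda>t x. W t - w t x" and r=s and ?T0.0=0 and ?T1.0=t and D=D and C=\<theta>])
      show "continuous_on {p. 0 \<le> fst p \<and> fst p \<le> t \<and> 0 \<le> snd p \<and> snd p \<le> s (fst p)} (\<lambda>p. W (fst p) - w (fst p) (snd p))"
        unfolding W_def by (intro continuous_intros cont_w_below) auto
      show "continuous_on {0..t} s" using cont_s by (rule continuous_on_subset) auto
      show "0 \<le> W 0 - w 0 y" if "0 \<le> y" "y \<le> s 0" for y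
        using B(2)[of 0 y] that s_init \<theta>_pos by (auto simp: W_def)
      show "0 \<le> W r - w r (s r)" if "0 < r" "r \<le> t" "0 \<le> s r" for r
        using zero_beyond[of r "s r"] that \<theta>_pos B by (auto simp: W_def)
      show "0 \<le> W r - w r 0 \<or> (\<exists>p\<le>0. ((\<lambda>x. W r - w r x) has_real_derivative p) (at 0 within {0..s r}))"
        if "0 < r" "r \<le> t" "0 < s r" for r
        using DERIV_diff[OF DERIV_const w_neumann[of r]] that by force
      show "\<exists>zt zxx. jet (\<lambda>t x. W t - w t x) r y zt zxx \<and> \<theta> * (W r - w r y) \<le> zt - D * zxx"
        if r: "0 < r" "r \<le> t" "0 < y" "y < s r" "W r - w r y < 0" for r y
      proof -
        let ?e = "exp (- \<theta> * r)"
        have "(W has_real_derivative - \<theta> * (B * ?e)) (at r)"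
          unfolding W_def by (auto intro!: derivative_eq_intros)
        then have jW: "jet (\<lambda>t x. W t) r y (- \<theta> * (B * ?e)) 0" by (rule jet_time_only)
        obtain wt wxx where w: "jet w r y wt wxx" "wt - D * wxx = F r y" using w_jet r by blast
        have "W r * (\<theta> - W r) \<le> - \<theta> * (B * ?e)"
          using zero_le_square[of "B * ?e"] by (simp add: W_def algebra_simps)
        moreover have "\<theta> * (W r - w r y) \<le> W r * (\<theta> - W r) - w r y * (\<theta> - w r y)"
        proof (rule logistic_difference)
          show "0 \<le> w r y + W r" using w_nonneg[of r y] r \<theta>_pos B by (auto simp: W_def)
        qed (use r in auto)
        ultimately have "\<theta> * (W r - w r y) \<le> - \<theta> * (B * ?e) - F r y"
          using F_le[of r y] r by auto
        then show ?thesis using jet_diff[OF jW w(1)] w(2)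
          by (intro exI[of _ "- \<theta> * (B * ?e) - wt"] exI[of _ "0 - wxx"]) (simp add: algebra_simps)
      qed
    qed (use D_pos tx True in auto)
    then show ?thesis by simp
  qed
  have "((\<lambda>t. \<theta> + B * exp (- (\<theta> * t))) \<longlongrightarrow> \<theta> + B * 0) at_top"
  proof (intro tendsto_intros)
    have "filterlim (\<lambda>t. \<theta> * t) at_top at_top"
      using \<theta>_pos by (intro filterlim_tendsto_pos_mult_at_top[OF tendsto_const]) (auto intro: filterlim_ident)
    then show "((\<lambda>t. exp (- (\<theta> * t))) \<longlongrightarrow> 0) at_top"
      by (intro filterlim_compose[OF exp_at_bot] filterlim_compose[OF filterlim_uminus_at_bot_at_top])
  qed
  then have "\<forall>\<^sub>F t in at_top. W t < \<theta> + \<epsilon>"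
    using order_tendstoD(2)[of W \<theta> at_top "\<theta> + \<epsilon>"] assms by (simp add: W_def[abs_def])
  then obtain T where T: "\<And>t. T \<le> t \<Longrightarrow> W t < \<theta> + \<epsilon>" unfolding eventually_at_top_linorder by blast
  show ?thesis
  proof (intro exI conjI allI impI)
    fix t x :: real assume "max 0 T \<le> t" "0 \<le> x"
    then show "w t x \<le> \<theta> + \<epsilon>" using le[of t x] T[of t] by simp
  qed simp
qed

lemma front_upper_bound:
  assumes wave: "semi_wave m D \<theta> k q" and k: "k > 0" and \<delta>: "\<delta> > 0"
  shows "\<exists>T\<ge>0. \<exists>G. \<forall>t\<ge>T. s t < G + (1 + 2 * \<delta>) * k * (t - T)"
proof -
  obtain q' q'' where dq: "\<And>x. x \<ge> 0 \<Longrightarrow> (q has_real_derivative q' x) (at x within {0..})"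
    and dq1: "\<And>x. x > 0 \<Longrightarrow> (q has_real_derivative q' x) (at x)"
    and cq: "continuous_on {0..} q"
    and dq': "\<And>x. x > 0 \<Longrightarrow> (q' has_real_derivative q'' x) (at x)"
    and ode: "\<And>x. x > 0 \<Longrightarrow> D * q'' x - k * q' x + q x * (\<theta> - q x) = 0"
    and q0: "q 0 = 0" "q' 0 = k / m" and lim: "(q \<longlongrightarrow> \<theta>) at_top" and q'pos: "\<And>x. x > 0 \<Longrightarrow> q' x > 0"
    and mono: "\<And>x y. 0 \<le> x \<Longrightarrow> x < y \<Longrightarrow> q x < q y" and lt: "\<And>x. 0 \<le> x \<Longrightarrow> q x < \<theta>"
    by (rule semi_waveE[OF wave]) blast
  have q_nonneg: "0 \<le> q x" if "0 \<le> x" for x using mono[of 0 x] q0 that by (cases "x = 0") auto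
  obtain T where T: "T \<ge> 0" "\<And>t x. T \<le> t \<Longrightarrow> 0 \<le> x \<Longrightarrow> w t x \<le> \<theta> + \<theta> * \<delta> / 2"
    using eventually_below[of "\<theta> * \<delta> / 2"] \<theta>_pos \<delta> by auto
  define A where "A = 1 + \<delta>"
  have A: "A > 1" using \<delta> by (simp add: A_def)
  have "(\<theta> + \<theta> * \<delta> / 2) / A < \<theta>" using \<theta>_pos \<delta> A by (simp add: A_def field_simps)
  then have "\<forall>\<^sub>F x in at_top. (\<theta> + \<theta> * \<delta> / 2) / A < q x \<and> 0 < x"
    using order_tendstoD(1)[OF lim] eventually_gt_at_top[of 0] by (auto intro: eventually_conj)
  then obtain x0 where x0: "(\<theta> + \<theta> * \<delta> / 2) / A < q x0" "0 < x0"
    using eventually_happens[of _ "at_top::real filter"] by auto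
  define \<sigma> where "\<sigma> t = s T + x0 + (1 + 2 * \<delta>) * k * (t - T)" for t
  have \<sigma>_pos: "0 < \<sigma> t" if "T \<le> t" for t
    using s_pos[OF T(1)] x0 k \<delta> that by (auto simp: \<sigma>_def intro!: add_pos_nonneg)
  have c\<sigma>: "continuous_on {T..} \<sigma>" unfolding \<sigma>_def by (intro continuous_intros)
  have d\<sigma>: "(\<sigma> has_real_derivative (1 + 2 * \<delta>) * k) (at t)" for t
    unfolding \<sigma>_def by (auto intro!: derivative_eq_intros)
  have "s t < \<sigma> t" if "T \<le> t" for t
  proof (rule below_supersolution[where W="\<lambda>t x. A * q (\<sigma> t - x)" and \<sigma>=\<sigma> and \<sigma>'="\<lambda>_. (1 + 2 * \<delta>) * k" and T=T and C=\<theta>])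
    show "continuous_on {p. T \<le> fst p \<and> 0 \<le> snd p \<and> snd p \<le> \<sigma> (fst p)} (\<lambda>p. A * q (\<sigma> (fst p) - snd p))"
      by (rule continuous_on_travelling[OF cq c\<sigma>])
    show "0 \<le> A * q (\<sigma> t - x)" if "x \<le> \<sigma> t" for t x using q_nonneg A that by auto
    show "\<exists>l. ((\<lambda>x. A * q (\<sigma> t - x)) has_real_derivative l) (at (\<sigma> t) within {0..\<sigma> t}) \<and> - m * l < (1 + 2 * \<delta>) * k"
      if "0 < \<sigma> t" for t
    proof (intro exI conjI)
      show "((\<lambda>x. A * q (\<sigma> t - x)) has_real_derivative - A * q' 0) (at (\<sigma> t) within {0..\<sigma> t})"
        using travelling_space_derivative[OF dq, of "\<sigma> t" "\<sigma> t" A] that by simp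
      have "- m * (- A * q' 0) = A * k" using q0 m_pos by simp
      also have "\<dots> < (1 + 2 * \<delta>) * k" using k \<delta> by (simp add: A_def)
      finally show "- m * (- A * q' 0) < (1 + 2 * \<delta>) * k" .
    qed
    show "\<exists>p\<le>0. ((\<lambda>x. A * q (\<sigma> t - x)) has_real_derivative p) (at 0 within {0..\<sigma> t})" if "0 < \<sigma> t" for t
      using travelling_space_derivative[OF dq, of 0 "\<sigma> t" A] that q'pos[of "\<sigma> t"] A
      by (intro exI[of _ "- A * q' (\<sigma> t)"]) auto
    show "s T < \<sigma> T" using x0 by (simp add: \<sigma>_def)
    show "w T x \<le> A * q (\<sigma> T - x)" if "0 \<le> x" "x \<le> s T" for x
    proof -
      have "q x0 \<le> q (\<sigma> T - x)" using mono[of x0 "\<sigma> T - x"] x0 that by (cases "x = s T") (auto simp: \<sigma>_def)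
      then have "(\<theta> + \<theta> * \<delta> / 2) / A \<le> q (\<sigma> T - x)" using x0 by simp
      then have "\<theta> + \<theta> * \<delta> / 2 \<le> A * q (\<sigma> T - x)" using A by (simp add: field_simps)
      then show ?thesis using T(2)[of T x] that by simp
    qed
    show "\<exists>Wt Wxx. jet (\<lambda>t x. A * q (\<sigma> t - x)) t x Wt Wxx \<and>
        \<theta> * (A * q (\<sigma> t - x) - w t x) \<le> Wt - D * Wxx - F t x"
      if tx: "T < t" "0 < x" "x < s t" "s t \<le> \<sigma> t" "A * q (\<sigma> t - x) < w t x" for t x
    proof -
      let ?y = "\<sigma> t - x"
      have y: "?y > 0" using tx by simp
      have "A * (q' ?y * ((1 + 2 * \<delta>) * k)) - D * (A * q'' ?y)
          = A * (2 * \<delta> * k * q' ?y) + A * (q ?y * (\<theta> - q ?y))"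
      proof -
        have "D * q'' ?y = k * q' ?y - q ?y * (\<theta> - q ?y)" using ode[OF y] by simp
        then have "A * (D * q'' ?y) = A * (k * q' ?y - q ?y * (\<theta> - q ?y))" by simp
        then show ?thesis by (simp add: algebra_simps)
      qed
      moreover have "0 \<le> A * (2 * \<delta> * k * q' ?y)" using A \<delta> k q'pos[OF y] by simp
      moreover have "A * q ?y * (\<theta> - A * q ?y) \<le> A * (q ?y * (\<theta> - q ?y))"
      proof -
        have "1 * q ?y \<le> A * q ?y" using A q_nonneg[of ?y] y by (intro mult_right_mono) auto
        then have "A * q ?y * (\<theta> - A * q ?y) \<le> A * q ?y * (\<theta> - q ?y)"
          using A q_nonneg[of ?y] y by (intro mult_left_mono) auto
        then show ?thesis by (simp add: mult_ac)
      qed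
      moreover have "\<theta> * (A * q ?y - w t x) \<le> A * q ?y * (\<theta> - A * q ?y) - w t x * (\<theta> - w t x)"
        by (rule logistic_difference) (use tx w_nonneg[of t x] T q_nonneg[of ?y] A y in auto)
      moreover have "F t x \<le> w t x * (\<theta> - w t x)" using F_le tx T by auto
      ultimately have "\<theta> * (A * q ?y - w t x) \<le> A * (q' ?y * ((1 + 2 * \<delta>) * k)) - D * (A * q'' ?y) - F t x"
        by linarith
      then show ?thesis using jet_travelling[OF dq1 dq' d\<sigma>, of x t A] tx by fastforce
    qed
  qed (use T c\<sigma> d\<sigma> q0 that in auto)
  then show ?thesis using T(1) unfolding \<sigma>_def by blast
qed

end

locale logistic_above = positive_free_boundary 1 m F s0 w0 w s for m F s0 w0 w s +
  fixes c :: "real \<Rightarrow> real \<Rightarrow> real"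
  assumes F_eq: "\<And>t x. F t x = w t x * c t x"
    and c_cont: "continuous_on {p. 0 \<le> fst p \<and> 0 \<le> snd p} (\<lambda>p. c (fst p) (snd p))"
    and c_ge: "\<And>t x. 0 \<le> t \<Longrightarrow> 0 \<le> x \<Longrightarrow> 1 - w t x \<le> c t x"
    and w0_pos: "\<And>x. 0 \<le> x \<Longrightarrow> x < s0 \<Longrightarrow> 0 < w0 x"
begin

text \<open>
  The barrier is \<open>\<eta> exp (-K (t - T0)) (\<rho>(t) - x\<^sup>2)\<^sup>2\<close> with \<open>\<rho>\<close> growing linearly from \<open>R0\<^sup>2\<close> to \<open>R1\<^sup>2\<close>. The
  double zero at its edge lets the support move, which a cosine profile would not.
\<close>

lemma positivity_spreads:
  assumes T: "0 \<le> T0" "T0 < T1" and R: "0 < R0" "R0 \<le> R1" "R1 \<le> s T0"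
    and pos: "\<And>x. 0 \<le> x \<Longrightarrow> x \<le> R0 \<Longrightarrow> 0 < w T0 x" and x: "0 \<le> x" "x < R1"
  shows "0 < w T1 x"
proof -
  obtain B where B: "B \<ge> 0" "\<And>t x. 0 \<le> t \<Longrightarrow> t \<le> T1 \<Longrightarrow> 0 \<le> x \<Longrightarrow> x \<le> R1 \<Longrightarrow> \<bar>c t x\<bar> \<le> B"
    using continuous_on_quadrant_bounded[OF c_cont] by metis
  have "continuous_on {0..R0} (w T0)" using cont_w_space[OF T(1)] by (rule continuous_on_subset) auto
  then obtain xm where xm: "xm \<in> {0..R0}" "\<forall>x\<in>{0..R0}. w T0 xm \<le> w T0 x"
    using continuous_attains_inf[OF compact_Icc, of 0 R0 "w T0"] R by auto
  define \<gamma> where "\<gamma> = (R1\<^sup>2 - R0\<^sup>2) / (T1 - T0)"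
  have "R0\<^sup>2 \<le> R1\<^sup>2" using R by (intro power_mono) auto
  then have \<gamma>: "\<gamma> \<ge> 0" using T by (simp add: \<gamma>_def)
  define \<rho> where "\<rho> t = R0\<^sup>2 + \<gamma> * (t - T0)" for t
  have \<rho>1: "\<rho> T1 = R1\<^sup>2" using T by (simp add: \<rho>_def \<gamma>_def)
  have \<rho>_ge: "R0\<^sup>2 \<le> \<rho> t" if "T0 \<le> t" for t using \<gamma> that by (simp add: \<rho>_def)
  have \<rho>_le: "\<rho> t \<le> R1\<^sup>2" if "t \<le> T1" for t
  proof -
    have "\<rho> t \<le> \<rho> T1" using \<gamma> that by (simp add: \<rho>_def mult_left_mono)
    then show ?thesis using \<rho>1 by simp
  qed
  have R0sq: "R0\<^sup>2 > 0" using R by simp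
  define \<eta> where "\<eta> = w T0 xm / (R0\<^sup>2)\<^sup>2"
  have \<eta>: "\<eta> > 0" using pos[of xm] xm R0sq by (simp add: \<eta>_def)
  define L where "L = 2 * \<gamma> + 12"
  define K where "K = B + L\<^sup>2 / (32 * R0\<^sup>2)"
  define V where "V t x = \<eta> * exp (- K * (t - T0)) * (\<rho> t - x\<^sup>2)\<^sup>2" for t x
  define r where "r t = sqrt (\<rho> t)" for t
  have r_le: "r t \<le> R1" if "t \<le> T1" for t
    using real_sqrt_le_mono[OF \<rho>_le[OF that]] R by (simp add: r_def)
  have r_pos: "0 < r t" if "T0 \<le> t" for t using \<rho>_ge[OF that] R0sq unfolding r_def real_sqrt_gt_0_iff by linarith
  have r_sq: "(r t)\<^sup>2 = \<rho> t" if "T0 \<le> t" for t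
    using r_pos[OF that] unfolding r_def by simp
  have rs: "r t \<le> s t" if "T0 \<le> t" "t \<le> T1" for t
    using r_le[of t] R s_mono[of T0 t] T that by auto
  have "0 \<le> w T1 x - V T1 x"
  proof (rule minimum_principle[where z="\<lambda>t x. w t x - V t x" and r=r and ?T0.0=T0 and ?T1.0=T1 and D=1 and C=0])
    show "continuous_on {p. T0 \<le> fst p \<and> fst p \<le> T1 \<and> 0 \<le> snd p \<and> snd p \<le> r (fst p)}
        (\<lambda>p. w (fst p) (snd p) - V (fst p) (snd p))"
      unfolding V_def \<rho>_def by (intro continuous_intros cont_w_below T)
    show "continuous_on {T0..T1} r" unfolding r_def \<rho>_def by (intro continuous_intros)
    show "0 \<le> w T0 y - V T0 y" if y: "0 \<le> y" "y \<le> r T0" for y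
    proof -
      have y': "y \<le> R0" using y R by (simp add: r_def \<rho>_def)
      then have "y\<^sup>2 \<le> R0\<^sup>2" using y by (intro power_mono) auto
      then have "(\<rho> T0 - y\<^sup>2)\<^sup>2 \<le> (R0\<^sup>2)\<^sup>2" by (intro power_mono) (auto simp: \<rho>_def)
      then have "V T0 y \<le> \<eta> * (R0\<^sup>2)\<^sup>2" using \<eta> by (simp add: V_def)
      also have "\<dots> = w T0 xm" using R0sq by (simp add: \<eta>_def)
      also have "\<dots> \<le> w T0 y" using xm y y' by simp
      finally show ?thesis by simp
    qed
    show "0 \<le> w t (r t) - V t (r t)" if "T0 < t" "t \<le> T1" "0 \<le> r t" for t
      using w_nonneg[of t "r t"] r_sq[of t] that T by (simp add: V_def)
    show "0 \<le> w t 0 - V t 0 \<or> (\<exists>p\<le>0. ((\<lambda>x. w t x - V t x) has_real_derivative p) (at 0 within {0..r t}))"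
      if t: "T0 < t" "t \<le> T1" "0 < r t" for t
    proof -
      have "(V t has_real_derivative 0) (at 0 within {0..r t})"
        unfolding V_def by (auto intro!: derivative_eq_intros)
      moreover have "(w t has_real_derivative 0) (at 0 within {0..r t})"
        by (rule DERIV_subset[OF w_neumann]) (use t T rs[of t] s_pos[of t] in auto)
      ultimately have "((\<lambda>x. w t x - V t x) has_real_derivative 0 - 0) (at 0 within {0..r t})"
        by (intro DERIV_diff)
      then show ?thesis by auto
    qed
    show "\<exists>zt zxx. jet (\<lambda>t x. w t x - V t x) t y zt zxx \<and> 0 * (w t y - V t y) \<le> zt - 1 * zxx"
      if t: "T0 < t" "t \<le> T1" "0 < y" "y < r t" "w t y - V t y < 0" for t y
    proof -
      define E where "E = \<eta> * exp (- K * (t - T0))"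
      define S where "S = \<rho> t - y\<^sup>2"
      have E: "E > 0" using \<eta> by (simp add: E_def)
      have "y\<^sup>2 \<le> (r t)\<^sup>2" using t by (intro power_mono) auto
      then have S: "S \<ge> 0" using r_sq[of t] t by (simp add: S_def)
      have VE: "V t y = E * S\<^sup>2" by (simp add: V_def E_def S_def)
      have jV: "jet V t y (E * (- K * S\<^sup>2 + 2 * \<gamma> * S)) (E * (8 * y\<^sup>2 - 4 * S))"
        unfolding jet_def
      proof (intro conjI exI)
        show "((\<lambda>\<tau>. V \<tau> y) has_real_derivative E * (- K * S\<^sup>2 + 2 * \<gamma> * S)) (at t)"
          unfolding V_def \<rho>_def E_def S_def
          by (auto intro!: derivative_eq_intros simp: algebra_simps)
        show "\<forall>\<^sub>F x in nhds y. (V t has_real_derivative E * (- 4 * x * (\<rho> t - x\<^sup>2))) (at x)"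
          unfolding V_def E_def by (intro always_eventually allI) (auto intro!: derivative_eq_intros)
        show "((\<lambda>x. E * (- 4 * x * (\<rho> t - x\<^sup>2))) has_real_derivative E * (8 * y\<^sup>2 - 4 * S)) (at y)"
          unfolding S_def by (auto intro!: derivative_eq_intros simp: power2_eq_square algebra_simps)
      qed
      obtain wt wxx where w: "jet w t y wt wxx" "wt - 1 * wxx = F t y"
        using w_jet[of t y] t T rs[of t] by auto
      have wty: "0 \<le> w t y" using w_nonneg[of t y] t T by auto
      have "- B \<le> c t y" using B(2)[of t y] t T r_le[of t] by auto
      then have "- B * w t y \<le> c t y * w t y" using wty by (rule mult_right_mono)
      then have "- B * w t y \<le> F t y" unfolding F_eq by (simp add: mult.commute)
      moreover have "B * w t y \<le> B * (E * S\<^sup>2)" using B(1) t(5) VE by (intro mult_left_mono) auto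
      ultimately have F: "- (B * (E * S\<^sup>2)) \<le> F t y" by linarith
      have square: "(L * S - 16 * N)\<^sup>2 / (32 * N) = L\<^sup>2 / (32 * N) * S\<^sup>2 - L * S + 8 * N" if "N > 0" for N
        using that by (simp add: field_simps power2_eq_square)
      have "0 \<le> (L * S - 16 * R0\<^sup>2)\<^sup>2 / (32 * R0\<^sup>2)" by simp
      also have "\<dots> = L\<^sup>2 / (32 * R0\<^sup>2) * S\<^sup>2 - L * S + 8 * R0\<^sup>2"
        by (rule square[OF R0sq])
      also have "\<dots> \<le> (K - B) * S\<^sup>2 - L * S + 8 * \<rho> t" using \<rho>_ge[of t] t by (simp add: K_def)
      also have "\<dots> = - B * S\<^sup>2 - ((- K * S\<^sup>2 + 2 * \<gamma> * S) - (8 * y\<^sup>2 - 4 * S))"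
        by (simp add: S_def L_def algebra_simps)
      finally have "0 \<le> E * (- B * S\<^sup>2 - ((- K * S\<^sup>2 + 2 * \<gamma> * S) - (8 * y\<^sup>2 - 4 * S)))"
        using E by simp
      then have "0 \<le> - (B * (E * S\<^sup>2)) - (E * (- K * S\<^sup>2 + 2 * \<gamma> * S) - E * (8 * y\<^sup>2 - 4 * S))"
        by (simp add: algebra_simps)
      with F have "0 \<le> wt - E * (- K * S\<^sup>2 + 2 * \<gamma> * S) - (wxx - E * (8 * y\<^sup>2 - 4 * S))"
        using w(2) by linarith
      then show ?thesis using jet_diff[OF w(1) jV] by fastforce
    qed
    show "x \<le> r T1" using x R by (simp add: r_def \<rho>1)
  qed (use T x in auto)
  moreover have "x\<^sup>2 < R1\<^sup>2" using x by (intro power_strict_mono) auto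
  then have "0 < V T1 x" using \<eta> \<rho>1 by (simp add: V_def)
  ultimately show ?thesis by simp
qed

lemma cosine_lower_bound:
  assumes T: "0 \<le> T" and R: "0 < R" "R \<le> s T" and pos: "\<And>x. 0 \<le> x \<Longrightarrow> x \<le> R \<Longrightarrow> 0 < w T x"
    and K: "0 < K" "K = 1 - (pi / (2 * R))\<^sup>2"
  shows "\<exists>m0>0. m0 < K \<and> (\<forall>t\<ge>T. K - (K - m0) * exp (- m0 * (t - T)) \<le> w t 0)"
proof -
  have "continuous_on {0..R} (w T)" using cont_w_space[OF T] by (rule continuous_on_subset) auto
  then obtain xm where xm: "xm \<in> {0..R}" "\<forall>x\<in>{0..R}. w T xm \<le> w T x"
    using continuous_attains_inf[OF compact_Icc, of 0 R "w T"] R by auto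
  define m0 where "m0 = min (w T xm) (K/2)"
  have "0 < w T xm" using pos[of xm] xm by auto
  then have m0: "0 < m0" "m0 < K" "m0 \<le> w T xm" using K(1) unfolding m0_def by linarith+
  define a where "a t = K - (K - m0) * exp (- m0 * (t - T))" for t
  have a_bounds: "m0 \<le> a t" "a t \<le> K" if "T \<le> t" for t
  proof -
    have "exp (- m0 * (t - T)) \<le> 1" using m0 that by simp
    then have "(K - m0) * exp (- m0 * (t - T)) \<le> (K - m0) * 1" using m0 by (intro mult_left_mono) auto
    then show "m0 \<le> a t" by (simp add: a_def)
    show "a t \<le> K" using m0 by (simp add: a_def)
  qed
  define \<omega> where "\<omega> = pi / (2 * R)"
  define V where "V t x = a t * cos (\<omega> * x)" for t x
  have cos_nonneg: "0 \<le> cos (\<omega> * x)" if "0 \<le> x" "x \<le> R" for x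
  proof (rule cos_ge_zero)
    have "\<omega> * x \<le> \<omega> * R" using that R by (intro mult_left_mono) (auto simp: \<omega>_def)
    then show "\<omega> * x \<le> pi / 2" using R by (simp add: \<omega>_def)
    have "0 \<le> \<omega> * x" using that R by (simp add: \<omega>_def)
    then show "- (pi / 2) \<le> \<omega> * x" using pi_gt_zero by linarith
  qed
  have Rs: "R \<le> s t" if "T \<le> t" for t using s_mono[of T t] R T that by auto
  have "a t \<le> w t 0" if "T \<le> t" for t
  proof -
    have "0 \<le> w t 0 - V t 0"
    proof (rule minimum_principle[where z="\<lambda>t x. w t x - V t x" and r="\<lambda>_. R" and ?T0.0=T and ?T1.0=t and D=1 and C=1])
      show "continuous_on {p. T \<le> fst p \<and> fst p \<le> t \<and> 0 \<le> snd p \<and> snd p \<le> R}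
        (\<lambda>p. w (fst p) (snd p) - V (fst p) (snd p))"
        unfolding V_def a_def by (intro continuous_intros cont_w_below T)
      show "0 \<le> w T y - V T y" if y: "0 \<le> y" "y \<le> R" for y
      proof -
        have "V T y \<le> m0 * 1" unfolding V_def a_def using m0 by (intro mult_mono) (auto intro: cos_nonneg y)
        moreover have "w T xm \<le> w T y" using xm(2) y by auto
        ultimately show ?thesis using m0(3) by linarith
      qed
      show "0 \<le> w r R - V r R" if "T < r" for r
      proof -
        have "\<omega> * R = pi / 2" using R by (simp add: \<omega>_def)
        then have "cos (\<omega> * R) = 0" by (simp only: cos_pi_half)
        then show ?thesis using w_nonneg[of r R] R T that by (simp add: V_def)
      qed
      show "0 \<le> w r 0 - V r 0 \<or> (\<exists>p\<le>0. ((\<lambda>x. w r x - V r x) has_real_derivative p) (at 0 within {0..R}))"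
        if r: "T < r" for r
      proof -
        have "(V r has_real_derivative 0) (at 0 within {0..R})"
          unfolding V_def by (auto intro!: derivative_eq_intros)
        moreover have "(w r has_real_derivative 0) (at 0 within {0..R})"
          by (rule DERIV_subset[OF w_neumann]) (use r T Rs[of r] s_pos[of r] in auto)
        ultimately have "((\<lambda>x. w r x - V r x) has_real_derivative 0 - 0) (at 0 within {0..R})"
          by (intro DERIV_diff)
        then show ?thesis by auto
      qed
      show "\<exists>zt zxx. jet (\<lambda>t x. w t x - V t x) r y zt zxx \<and> 1 * (w r y - V r y) \<le> zt - 1 * zxx"
        if r: "T < r" "r \<le> t" "0 < y" "y < R" "w r y - V r y < 0" for r y
      proof -
        let ?C = "cos (\<omega> * y)"
        have C: "0 \<le> ?C" "?C \<le> 1" using cos_nonneg[of y] r by auto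
        have ar: "m0 \<le> a r" "a r \<le> K" using a_bounds[of r] r by auto
        have da: "(a has_real_derivative m0 * (K - a r)) (at r)"
          unfolding a_def by (auto intro!: derivative_eq_intros simp: algebra_simps)
        have jV: "jet V r y (m0 * (K - a r) * ?C) (- (a r * \<omega>\<^sup>2 * ?C))"
          unfolding jet_def
        proof (intro conjI exI)
          show "((\<lambda>\<tau>. V \<tau> y) has_real_derivative m0 * (K - a r) * ?C) (at r)"
            unfolding V_def by (auto intro!: derivative_eq_intros da)
          show "\<forall>\<^sub>F x in nhds y. (V r has_real_derivative - (a r * \<omega> * sin (\<omega> * x))) (at x)"
            unfolding V_def by (intro always_eventually allI) (auto intro!: derivative_eq_intros)
          show "((\<lambda>x. - (a r * \<omega> * sin (\<omega> * x))) has_real_derivative - (a r * \<omega>\<^sup>2 * ?C)) (at y)"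
            by (auto intro!: derivative_eq_intros simp: power2_eq_square)
        qed
        obtain wt wxx where w: "jet w r y wt wxx" "wt - 1 * wxx = F r y"
          using w_jet[of r y] r T Rs[of r] by auto
        have wry: "0 \<le> w r y" using w_nonneg[of r y] r T by auto
        have Vry: "0 \<le> V r y" using ar m0 C by (simp add: V_def)
        have "m0 * (K - a r) * ?C \<le> a r * (K - a r) * ?C"
          using ar C by (intro mult_right_mono) auto
        moreover have "a r * (K - a r) * ?C + a r * \<omega>\<^sup>2 * ?C = a r * ?C - (a r * a r) * ?C"
          by (simp add: K(2) \<omega>_def algebra_simps)
        moreover have "(a r * a r) * (?C * ?C) \<le> (a r * a r) * ?C"
          using C mult_left_mono[of ?C 1 ?C] by (intro mult_left_mono) auto
        ultimately have "m0 * (K - a r) * ?C + a r * \<omega>\<^sup>2 * ?C \<le> V r y * (1 - V r y)"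
          unfolding V_def by (simp add: algebra_simps)
        moreover have "1 * (w r y - V r y) \<le> w r y * (1 - w r y) - V r y * (1 - V r y)"
          by (rule logistic_difference) (use r wry Vry in auto)
        moreover have "w r y * (1 - w r y) \<le> F r y"
          unfolding F_eq using c_ge[of r y] wry r T by (intro mult_left_mono) auto
        moreover have "1 * z \<le> wt - i - 1 * (wxx - - j)"
          if "i + j \<le> f'" "1 * z \<le> f - f'" "f \<le> F r y" for i j f f' z :: real
          using w(2) that by simp
        ultimately have "1 * (w r y - V r y) \<le> wt - m0 * (K - a r) * ?C - 1 * (wxx - - (a r * \<omega>\<^sup>2 * ?C))"
          by blast
        then show ?thesis using jet_diff[OF w(1) jV] by blast
      qed
    qed (use T R that in auto)
    then show ?thesis by (simp add: V_def)
  qed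
  then show ?thesis using m0 unfolding a_def by blast
qed

lemma eventually_large_at_origin:
  assumes spread: "filterlim s at_top at_top" and \<epsilon>: "0 < \<epsilon>" "\<epsilon> < 1"
  shows "\<exists>T\<ge>0. \<forall>t\<ge>T. 1 - \<epsilon> < w t 0"
proof -
  define R where "R = pi / (2 * sqrt (\<epsilon>/2))"
  have R: "R > 0" using \<epsilon> by (simp add: R_def)
  define K where "K = 1 - (pi / (2 * R))\<^sup>2"
  have "(pi / (2 * R))\<^sup>2 = \<epsilon>/2" using \<epsilon> by (simp add: R_def)
  then have K: "K = 1 - \<epsilon>/2" "0 < K" using \<epsilon> by (auto simp: K_def)
  have "\<forall>\<^sub>F t in at_top. max R s0 + 1 \<le> s t \<and> 0 < t"
    using filterlim_at_top[THEN iffD1, OF spread] eventually_gt_at_top[of 0] by (auto intro: eventually_conj)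
  then obtain T where T: "max R s0 + 1 \<le> s T" "0 < T"
    using eventually_happens[of _ "at_top::real filter"] by auto
  have pos0: "0 < w T x" if "0 \<le> x" "x \<le> s0/2" for x
    by (rule positivity_spreads[of 0 T "s0/2" "3 * s0/4"]) (use T w_init w0_pos s_init s0_pos that in auto)
  have pos1: "0 < w (T+1) x" if "0 \<le> x" "x \<le> R" for x
    by (rule positivity_spreads[of T "T+1" "s0/2" "max R s0 + 1"]) (use T pos0 s0_pos that in auto)
  have "R \<le> s (T+1)" using T s_mono[of T "T+1"] by auto
  then obtain m0 where m0: "m0 > 0" "m0 < K" "\<And>t. t \<ge> T+1 \<Longrightarrow> K - (K - m0) * exp (- m0 * (t - (T+1))) \<le> w t 0"
    using cosine_lower_bound[of "T+1" R K] T R pos1 K K_def by auto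
  have "((\<lambda>t. K - (K - m0) * exp (- (m0 * (t - (T+1))))) \<longlongrightarrow> K - (K - m0) * 0) at_top"
  proof (intro tendsto_intros)
    have "filterlim (\<lambda>t. - (T+1) + t) at_top at_top"
      by (rule filterlim_tendsto_add_at_top[OF tendsto_const filterlim_ident])
    then have "filterlim (\<lambda>t. t - (T+1)) at_top at_top" by (simp add: algebra_simps)
    then have "filterlim (\<lambda>t. m0 * (t - (T+1))) at_top at_top"
      using m0 by (intro filterlim_tendsto_pos_mult_at_top[OF tendsto_const]) auto
    then show "((\<lambda>t. exp (- (m0 * (t - (T+1))))) \<longlongrightarrow> 0) at_top"
      by (intro filterlim_compose[OF exp_at_bot] filterlim_compose[OF filterlim_uminus_at_bot_at_top])
  qed
  then have "\<forall>\<^sub>F t in at_top. 1 - \<epsilon> < K - (K - m0) * exp (- (m0 * (t - (T+1))))"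
    using \<epsilon> K by (intro order_tendstoD(1)) auto
  then obtain T2 where T2: "\<And>t. T2 \<le> t \<Longrightarrow> 1 - \<epsilon> < K - (K - m0) * exp (- (m0 * (t - (T+1))))"
    unfolding eventually_at_top_linorder by blast
  show ?thesis
  proof (intro exI conjI allI impI)
    show "0 \<le> max (T+1) T2" using T by simp
    fix t assume "max (T+1) T2 \<le> t"
    then show "1 - \<epsilon> < w t 0" using m0(3)[of t] T2[of t] by simp
  qed
qed

lemma front_lower_bound:
  assumes spread: "filterlim s at_top at_top" and wave: "semi_wave m 1 1 k q" and k: "k > 0"
    and \<delta>: "0 < \<delta>" "\<delta> < 1/2"
  shows "\<exists>T\<ge>0. \<exists>H>0. \<forall>t\<ge>T. \<forall>x. 0 \<le> x \<longrightarrow> x \<le> H + (1 - 2 * \<delta>) * k * (t - T) \<longrightarrow>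
    (1 - \<delta>) * q (H + (1 - 2 * \<delta>) * k * (t - T) - x) \<le> w t x"
proof -
  obtain q' q'' where dq: "\<And>x. x \<ge> 0 \<Longrightarrow> (q has_real_derivative q' x) (at x within {0..})"
    and dq1: "\<And>x. x > 0 \<Longrightarrow> (q has_real_derivative q' x) (at x)"
    and cq: "continuous_on {0..} q"
    and dq': "\<And>x. x > 0 \<Longrightarrow> (q' has_real_derivative q'' x) (at x)"
    and ode: "\<And>x. x > 0 \<Longrightarrow> 1 * q'' x - k * q' x + q x * (1 - q x) = 0"
    and q0: "q 0 = 0" "q' 0 = k / m" and q'pos: "\<And>x. x > 0 \<Longrightarrow> q' x > 0"
    and mono: "\<And>x y. 0 \<le> x \<Longrightarrow> x < y \<Longrightarrow> q x < q y" and lt: "\<And>x. 0 \<le> x \<Longrightarrow> q x < 1"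
    by (rule semi_waveE[OF wave]) blast
  have q_nonneg: "0 \<le> q x" if "0 \<le> x" for x using mono[of 0 x] q0 that by (cases "x = 0") auto
  obtain T where T: "T \<ge> 0" "\<And>t. T \<le> t \<Longrightarrow> 1 - \<delta> < w t 0"
    using eventually_large_at_origin[OF spread, of \<delta>] \<delta> by auto
  define A where "A = 1 - \<delta>"
  have A: "0 < A" "A < 1" using \<delta> by (auto simp: A_def)
  have wT0: "w T 0 > 0" using T(2)[of T] \<delta> by auto
  have "\<exists>e>0. \<forall>x\<in>{0..}. dist x 0 < e \<longrightarrow> dist (w T x) (w T 0) < w T 0 / 2"
    using cont_w_space[OF T(1), unfolded continuous_on_iff, rule_format, of 0 "w T 0 / 2"] wT0 by auto
  then obtain e where e: "e > 0" "\<And>x. 0 \<le> x \<Longrightarrow> x < e \<Longrightarrow> \<bar>w T x - w T 0\<bar> < w T 0 / 2"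
    by (auto simp: dist_real_def)
  have "\<exists>e>0. \<forall>x\<in>{0..}. dist x 0 < e \<longrightarrow> dist (q x) (q 0) < w T 0 / 2"
    using cq[unfolded continuous_on_iff, rule_format, of 0 "w T 0 / 2"] wT0 by auto
  then obtain e' where e': "e' > 0" "\<And>x. 0 \<le> x \<Longrightarrow> x < e' \<Longrightarrow> \<bar>q x\<bar> < w T 0 / 2"
    using q0 by (auto simp: dist_real_def)
  define H where "H = min (min e e') (s T) / 2"
  have H: "0 < H" "H < e" "H < e'" "H < s T" using e(1) e'(1) s_pos[OF T(1)] by (auto simp: H_def)
  define \<sigma> where "\<sigma> t = H + (1 - 2 * \<delta>) * k * (t - T)" for t
  have c\<sigma>: "continuous_on {T..} \<sigma>" unfolding \<sigma>_def by (intro continuous_intros)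
  have d\<sigma>: "(\<sigma> has_real_derivative (1 - 2 * \<delta>) * k) (at t)" for t
    unfolding \<sigma>_def by (auto intro!: derivative_eq_intros)
  have \<sigma>_pos: "0 < \<sigma> t" if "T \<le> t" for t
    using H(1) \<delta> k that by (auto simp: \<sigma>_def intro!: add_pos_nonneg)
  have "A * q (\<sigma> t - x) \<le> w t x" if tx: "T \<le> t" "0 \<le> x" "x \<le> \<sigma> t" for t x
  proof (rule above_subsolution(2)[where V="\<lambda>t x. A * q (\<sigma> t - x)" and \<sigma>=\<sigma> and \<sigma>'="\<lambda>_. (1 - 2 * \<delta>) * k" and T=T and C=1])
    show "continuous_on {p. T \<le> fst p \<and> 0 \<le> snd p \<and> snd p \<le> \<sigma> (fst p)} (\<lambda>p. A * q (\<sigma> (fst p) - snd p))"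
      by (rule continuous_on_travelling[OF cq c\<sigma>])
    show "\<exists>l. ((\<lambda>x. A * q (\<sigma> t - x)) has_real_derivative l) (at (\<sigma> t) within {0..\<sigma> t}) \<and> (1 - 2 * \<delta>) * k < - m * l"
      if "0 < \<sigma> t" for t
    proof (intro exI conjI)
      show "((\<lambda>x. A * q (\<sigma> t - x)) has_real_derivative - A * q' 0) (at (\<sigma> t) within {0..\<sigma> t})"
        using travelling_space_derivative[OF dq, of "\<sigma> t" "\<sigma> t" A] that by simp
      have "(1 - 2 * \<delta>) * k < A * k" using k \<delta> by (simp add: A_def)
      also have "\<dots> = - m * (- A * q' 0)" using q0 m_pos by simp
      finally show "(1 - 2 * \<delta>) * k < - m * (- A * q' 0)" .
    qed
    show "A * q (\<sigma> t - 0) \<le> w t 0" if "T < t" for t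
    proof -
      have "A * q (\<sigma> t) \<le> A * 1" using lt[of "\<sigma> t"] \<sigma>_pos[of t] that A by (intro mult_left_mono) auto
      then show ?thesis using T(2)[of t] that by (simp add: A_def)
    qed
    show "\<sigma> T < s T" using H by (simp add: \<sigma>_def)
    show "A * q (\<sigma> T - x) \<le> w T x" if "0 \<le> x" "x \<le> \<sigma> T" for x
    proof -
      have x: "0 \<le> H - x" "x < e" "H - x < e'" using that H by (auto simp: \<sigma>_def)
      have "A * q (H - x) \<le> 1 * q (H - x)" using A q_nonneg[OF x(1)] by (intro mult_right_mono) auto
      also have "\<dots> \<le> w T 0 / 2" using e'(2)[OF x(1,3)] by auto
      also have "\<dots> \<le> w T x" using e(2)[OF that(1) x(2)] by linarith
      finally show ?thesis by (simp add: \<sigma>_def)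
    qed
    show "\<exists>Vt Vxx. jet (\<lambda>t x. A * q (\<sigma> t - x)) t x Vt Vxx \<and>
        1 * (w t x - A * q (\<sigma> t - x)) \<le> F t x - (Vt - 1 * Vxx)"
      if tx: "T < t" "0 < x" "x < \<sigma> t" "\<sigma> t \<le> s t" "w t x < A * q (\<sigma> t - x)" for t x
    proof -
      let ?y = "\<sigma> t - x"
      have y: "?y > 0" using tx by simp
      have "A * (q' ?y * ((1 - 2 * \<delta>) * k)) - 1 * (A * q'' ?y)
          = - (A * (2 * \<delta> * k * q' ?y)) + A * (q ?y * (1 - q ?y))"
      proof -
        have "q'' ?y = k * q' ?y - q ?y * (1 - q ?y)" using ode[OF y] by simp
        then have "A * q'' ?y = A * (k * q' ?y - q ?y * (1 - q ?y))" by simp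
        then show ?thesis by (simp add: algebra_simps)
      qed
      moreover have "0 \<le> A * (2 * \<delta> * k * q' ?y)" using A \<delta> k q'pos[OF y] by simp
      moreover have "A * (q ?y * (1 - q ?y)) \<le> A * q ?y * (1 - A * q ?y)"
      proof -
        have "A * q ?y \<le> 1 * q ?y" using A q_nonneg[of ?y] y by (intro mult_right_mono) auto
        then have "A * q ?y * (1 - q ?y) \<le> A * q ?y * (1 - A * q ?y)"
          using A q_nonneg[of ?y] y by (intro mult_left_mono) auto
        then show ?thesis by (simp add: mult_ac)
      qed
      moreover have "1 * (w t x - A * q ?y) \<le> w t x * (1 - w t x) - A * q ?y * (1 - A * q ?y)"
        by (rule logistic_difference) (use tx w_nonneg[of t x] T q_nonneg[of ?y] A y in auto)
      moreover have "w t x * (1 - w t x) \<le> F t x"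
        unfolding F_eq using c_ge[of t x] w_nonneg[of t x] tx T by (intro mult_left_mono) auto
      ultimately have "1 * (w t x - A * q ?y) \<le> F t x - (A * (q' ?y * ((1 - 2 * \<delta>) * k)) - 1 * (A * q'' ?y))"
        by linarith
      then show ?thesis using jet_travelling[OF dq1 dq' d\<sigma>, of x t A] tx by fastforce
    qed
  qed (use T c\<sigma> d\<sigma> q0 tx in auto)
  then show ?thesis using T(1) H(1) unfolding \<sigma>_def A_def by blast
qed

end

section \<open>The predator outruns the prey\<close>

theorem theorem5p3:
  fixes a b c d \<beta> \<mu> g0 h0 :: real
    and u0 v0 g h :: "real \<Rightarrow> real" and u v :: "real \<Rightarrow> real \<Rightarrow> real"
  assumes "a > 0" "b > 0" "c > 0" "d > 0" "\<beta> > 0" "\<mu> > 0"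
    and "0 < h0" "h0 \<le> g0"
    and "admissible_init g0 u0" "admissible_init h0 v0"
    and "fb_solution a b c d \<beta> \<mu> g0 h0 u0 v0 u v g h"
    and "kspeed \<beta> d a < kspeed \<mu> 1 1"
    and "b > a"
    and "filterlim h at_top at_top"
  shows "\<exists>L. (g \<longlongrightarrow> L) at_top"
proof -
  have u_comp: "fb_component d \<beta> (\<lambda>t x. u t x * (a - u t x - b * v t x)) g0 u0 u g"
    and v_comp: "fb_component 1 \<mu> (\<lambda>t x. v t x * (1 - v t x + c * u t x)) h0 v0 v h"
    using assms(11) unfolding fb_solution_def by auto
  interpret ub: free_boundary d \<beta> "\<lambda>t x. u t x * (a - u t x - b * v t x)" g0 u0 u g
    by unfold_locales (use u_comp assms in auto)
  interpret vb: free_boundary 1 \<mu> "\<lambda>t x. v t x * (1 - v t x + c * u t x)" h0 v0 v h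
    by unfold_locales (use v_comp assms in auto)
  have init_nonneg: "0 \<le> w0 x" if "admissible_init s0 w0" "0 \<le> x" for s0 w0 x
    using that unfolding admissible_init_def by (metis less_imp_le not_le order_refl)
  have u_nonneg: "0 \<le> u t x" if "0 \<le> t" "0 \<le> x" for t x
  proof (rule ub.nonneg_of_linear_reaction[where c="\<lambda>t x. a - u t x - b * v t x"])
    show "continuous_on {p. 0 \<le> fst p \<and> 0 \<le> snd p} (\<lambda>p. a - u (fst p) (snd p) - b * v (fst p) (snd p))"
      by (intro continuous_intros ub.cont_w vb.cont_w)
  qed (use init_nonneg[OF assms(9)] that in auto)
  have v_nonneg: "0 \<le> v t x" if "0 \<le> t" "0 \<le> x" for t x
  proof (rule vb.nonneg_of_linear_reaction[where c="\<lambda>t x. 1 - v t x + c * u t x"])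
    show "continuous_on {p. 0 \<le> fst p \<and> 0 \<le> snd p} (\<lambda>p. 1 - v (fst p) (snd p) + c * u (fst p) (snd p))"
      by (intro continuous_intros ub.cont_w vb.cont_w)
  qed (use init_nonneg[OF assms(10)] that in auto)
  interpret ul: logistic_below d \<beta> "\<lambda>t x. u t x * (a - u t x - b * v t x)" g0 u0 u g a
  proof
    show "u t x * (a - u t x - b * v t x) \<le> u t x * (a - u t x)" if "0 \<le> t" "0 \<le> x" for t x
      using u_nonneg[OF that] v_nonneg[OF that] assms by (intro mult_left_mono) auto
  qed (use u_nonneg assms in auto)
  interpret vl: logistic_above \<mu> "\<lambda>t x. v t x * (1 - v t x + c * u t x)" h0 v0 v h "\<lambda>t x. 1 - v t x + c * u t x"
  proof
    show "continuous_on {p. 0 \<le> fst p \<and> 0 \<le> snd p} (\<lambda>p. 1 - v (fst p) (snd p) + c * u (fst p) (snd p))"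
      by (intro continuous_intros ub.cont_w vb.cont_w)
    show "0 < v0 x" if "0 \<le> x" "x < h0" for x using assms(10) that unfolding admissible_init_def by blast
  qed (use u_nonneg v_nonneg assms in auto)
  define k l where "k = kspeed \<beta> d a" and "l = kspeed \<mu> 1 1"
  have kl: "k < l" using assms(12) by (simp add: k_def l_def)
  obtain p where p: "semi_wave \<beta> d a k p" and k: "0 < k"
    using kspeed_semi_wave[of \<beta> d a] assms by (auto simp: k_def)
  obtain q where q: "semi_wave \<mu> 1 1 l q" and l: "0 < l"
    using kspeed_semi_wave[of \<mu> 1 1] assms by (auto simp: l_def)
  have q_lim: "(q \<longlongrightarrow> 1) at_top" using q unfolding semi_wave_def by blast
  have q_mono: "q x \<le> q y" if "0 \<le> x" "x \<le> y" for x y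
  proof -
    have "\<And>x y. 0 \<le> x \<Longrightarrow> x < y \<Longrightarrow> q x < q y" by (rule semi_waveE[OF q]) blast
    then show ?thesis using that by (cases "x = y") (auto intro: less_imp_le)
  qed
  define \<delta> where "\<delta> = min (min (1/4) ((1 - a/b) / 2)) ((l - k) / (4 * (k + l)))"
  have ab: "a / b < 1" using assms by simp
  have "0 < (l - k) / (4 * (k + l))" using kl k l by simp
  moreover have "0 < min (min (1/4) ((1 - x) / 2)) y \<and> min (min (1/4) ((1 - x) / 2)) y < 1/2 \<and>
      x < 1 - min (min (1/4) ((1 - x) / 2)) y" if "0 < y" "x < 1" for x y :: real
    using that by (auto simp: min_def field_simps)
  ultimately have \<delta>: "0 < \<delta>" "\<delta> < 1/2" "a / b < 1 - \<delta>"
    using ab unfolding \<delta>_def by blast+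
  have "\<delta> \<le> (l - k) / (4 * (k + l))" by (simp add: \<delta>_def)
  then have "\<delta> * (4 * (k + l)) \<le> l - k" using k l by (simp add: pos_le_divide_eq)
  then have gap: "(1 + 2 * \<delta>) * k < (1 - 2 * \<delta>) * l" using kl by (simp add: algebra_simps)
  obtain T1 G where T1: "T1 \<ge> 0" "\<And>t. t \<ge> T1 \<Longrightarrow> g t < G + (1 + 2 * \<delta>) * k * (t - T1)"
    using ul.front_upper_bound[OF p k \<delta>(1)] by blast
  obtain T2 H where T2: "T2 \<ge> 0" "H > 0" and v_ge: "\<And>t x. t \<ge> T2 \<Longrightarrow> 0 \<le> x \<Longrightarrow> x \<le> H + (1 - 2 * \<delta>) * l * (t - T2) \<Longrightarrow>
      (1 - \<delta>) * q (H + (1 - 2 * \<delta>) * l * (t - T2) - x) \<le> v t x"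
    using vl.front_lower_bound[OF assms(14) q l \<delta>(1,2)] by blast
  have less_iff: "x / (1 - \<delta>) < y \<longleftrightarrow> x < (1 - \<delta>) * y" for x y
    using pos_divide_less_eq[of "1 - \<delta>" x y] \<delta> by (simp add: mult.commute)
  have "a / b / (1 - \<delta>) < 1" unfolding less_iff using \<delta> by simp
  then obtain \<rho> where \<rho>: "\<rho> < 1" "a / b / (1 - \<delta>) < \<rho>" using dense by blast
  then have \<rho>': "a / b < (1 - \<delta>) * \<rho>" unfolding less_iff by blast
  obtain Y where Y: "Y \<ge> 0" "\<rho> < q Y"
  proof -
    have "\<forall>\<^sub>F x in at_top. \<rho> < q x \<and> 0 \<le> x"
      using order_tendstoD(1)[OF q_lim \<rho>(1)] eventually_ge_at_top[of 0] by (rule eventually_conj)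
    then show thesis using that eventually_happens[of _ "at_top::real filter"] by auto
  qed
  define \<gamma> where "\<gamma> = (1 - 2 * \<delta>) * l - (1 + 2 * \<delta>) * k"
  have \<gamma>: "\<gamma> > 0" using gap by (simp add: \<gamma>_def)
  define T where "T = max (max T1 T2) ((Y + G + (1 - 2 * \<delta>) * l * T2) / \<gamma>)"
  have v_large: "(1 - \<delta>) * \<rho> \<le> v t x" if t: "T \<le> t" and x: "0 \<le> x" "x \<le> g t" for t x
  proof -
    have tT: "T1 \<le> t" "T2 \<le> t" "(Y + G + (1 - 2 * \<delta>) * l * T2) / \<gamma> \<le> t" using t by (auto simp: T_def)
    have "Y + G + (1 - 2 * \<delta>) * l * T2 \<le> \<gamma> * t" using tT(3) \<gamma> by (simp add: field_simps)
    moreover have "0 \<le> (1 + 2 * \<delta>) * k * T1" using \<delta> k T1 by simp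
    ultimately have Yx: "Y \<le> H + (1 - 2 * \<delta>) * l * (t - T2) - x"
      using T1(2)[OF tT(1)] x T2(2) by (simp add: \<gamma>_def algebra_simps)
    have "\<rho> \<le> q (H + (1 - 2 * \<delta>) * l * (t - T2) - x)" using q_mono[OF Y(1) Yx] Y(2) by simp
    then have "(1 - \<delta>) * \<rho> \<le> (1 - \<delta>) * q (H + (1 - 2 * \<delta>) * l * (t - T2) - x)"
      using \<delta> by (intro mult_left_mono) auto
    also have "\<dots> \<le> v t x" using v_ge[of t x] tT x Yx Y(1) by simp
    finally show ?thesis .
  qed
  define \<epsilon> where "\<epsilon> = b * ((1 - \<delta>) * \<rho>) - a"
  have \<epsilon>: "\<epsilon> > 0" using \<rho>' assms(2) by (simp add: \<epsilon>_def pos_divide_less_eq mult.commute)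
  have T0: "0 \<le> T" using T1(1) by (simp add: T_def)
  show ?thesis
  proof (rule ul.front_bounded_of_decay[OF T0 \<epsilon>])
    fix t x assume tx: "T < t" "0 < x" "x < g t"
    have ux: "0 \<le> u t x" using u_nonneg tx T0 by simp
    have "b * ((1 - \<delta>) * \<rho>) \<le> b * v t x" using v_large[of t x] tx assms by (intro mult_left_mono) auto
    then have "a - u t x - b * v t x \<le> - \<epsilon>" using ux by (simp add: \<epsilon>_def)
    then have "u t x * (a - u t x - b * v t x) \<le> u t x * - \<epsilon>" using ux by (rule mult_left_mono)
    then show "u t x * (a - u t x - b * v t x) \<le> - \<epsilon> * u t x" by (simp add: mult.commute)
  qed
qed

end
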